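(* Let $H$ be a Hopf algebra, $C$ a right $H$-module coalgebra, and let $f\colon C\to H$ be a total cointegral which is a coalgebra map, with convolution inverse $f^{-1}=S\circ f$. Then $C^D$ is a right-left anti Yetter-Drinfeld module over $H$ by the original action of $H$ and the coaction $$c\longmapsto f^{-1}(c^{(3)})f(c^{(1)})\otimes c^{(2)}.$$ Furthermore this module is stable if $$c=c^{(2)}\,f^{-1}(c^{(3)})f(c^{(1)}).$$
   Context: All Hopf algebras, algebras and coalgebras are over a field; every Hopf algebra $H$ has an invertible antipode $S$. Sweedler notation: $\Delta(c)=c^{(1)}\otimes c^{(2)}$; left coactions are $m\mapsto m_{\langle -1\rangle}\otimes m_{\langle 0\rangle}$. For a right $H$-module coalgebra $C$, let $I=\mathrm{span}\{ch-\varepsilon(h)c\}$ (a coideal), $D=C/I$ the quotient coalgebra, $\pi\colon C\to D$ the projection, and, with $D^*$ the algebraic dual of $D$, $C^D=\{c\in C: c^{(1)}\varphi(\pi(c^{(2)}))=c^{(2)}\varphi(\pi(c^{(1)}))\ \text{for all }\varphi\in D^*\}$. A total cointegral is a linear map $f\colon C\to H$ with $\varepsilon(f(c))=\varepsilon(c)$ and $f(ch)=f(c)h$. A right $H$-module and left $H$-comodule $M$ (coaction $\rho$) is a right-left anti Yetter-Drinfeld module if $\rho(mh)=S(h^{(3)})m_{\langle -1\rangle}h^{(1)}\otimes m_{\langle 0\rangle}h^{(2)}$; it is stable if $m_{\langle 0\rangle}m_{\langle -1\rangle}=m$ for all $m$. *)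

theory Defs
  imports Complex_Main "HOL-Library.Function_Algebras"
begin

section \<open>Tensor products of vector spaces\<close>

text \<open>
  A vector space is a type together with a scalar multiplication over \<^typ>\<open>'k::field\<close> in the sense
  of \<^locale>\<open>vector_space\<close>, or a subspace of one. The tensor product is realised inside the dual
  of the space of bilinear forms: the pure tensor of \<open>a\<close> and \<open>b\<close> is evaluation of bilinear forms
  at \<open>(a, b)\<close>, and the tensor product of two subspaces is the span of the pure tensors of their
  elements. Over a field this is the usual tensor product: pure tensors are bilinear, they
  generate, and every bilinear map factors through them (\<open>tensor_add_left\<close> etc.,
  \<open>tensor_space_sum_list\<close> and \<open>tensor_lift_sum_list\<close> below).
\<close>

definition bilinear_on ::
  "('k::field \<Rightarrow> 'a \<Rightarrow> 'a) \<Rightarrow> ('k \<Rightarrow> 'b \<Rightarrow> 'b) \<Rightarrow> ('k \<Rightarrow> 'w \<Rightarrow> 'w) \<Rightarrow>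
   'a::ab_group_add set \<Rightarrow> 'b::ab_group_add set \<Rightarrow> ('a \<Rightarrow> 'b \<Rightarrow> 'w::ab_group_add) \<Rightarrow> bool"
  where "bilinear_on sA sB sW A B g \<longleftrightarrow>
    (\<forall>a\<in>A. \<forall>a'\<in>A. \<forall>b\<in>B. g (a + a') b = g a b + g a' b) \<and>
    (\<forall>a\<in>A. \<forall>b\<in>B. \<forall>b'\<in>B. g a (b + b') = g a b + g a b') \<and>
    (\<forall>k. \<forall>a\<in>A. \<forall>b\<in>B. g (sA k a) b = sW k (g a b) \<and> g a (sB k b) = sW k (g a b))"

type_synonym ('k, 'a, 'b) tensor = "('a \<Rightarrow> 'b \<Rightarrow> 'k) \<Rightarrow> 'k"

definition tensor ::
  "('k::field \<Rightarrow> 'a \<Rightarrow> 'a) \<Rightarrow> ('k \<Rightarrow> 'b \<Rightarrow> 'b) \<Rightarrow>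
   'a::ab_group_add \<Rightarrow> 'b::ab_group_add \<Rightarrow> ('k, 'a, 'b) tensor"
  where "tensor sA sB a b = (\<lambda>\<beta>. if bilinear_on sA sB (*) UNIV UNIV \<beta> then \<beta> a b else 0)"

definition tensor_scale :: "'k::field \<Rightarrow> ('k, 'a, 'b) tensor \<Rightarrow> ('k, 'a, 'b) tensor"
  where "tensor_scale k t = (\<lambda>\<beta>. k * t \<beta>)"

definition tensor_space ::
  "('k::field \<Rightarrow> 'a \<Rightarrow> 'a) \<Rightarrow> ('k \<Rightarrow> 'b \<Rightarrow> 'b) \<Rightarrow>
   'a::ab_group_add set \<Rightarrow> 'b::ab_group_add set \<Rightarrow> ('k, 'a, 'b) tensor set"
  where "tensor_space sA sB A B = module.span tensor_scale {tensor sA sB a b |a b. a \<in> A \<and> b \<in> B}"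

text \<open>
  The value at \<open>t\<close> of the linear map on the tensor product of \<open>A\<close> and \<open>B\<close> that is induced by the
  bilinear map \<open>g\<close>.
\<close>

definition tensor_lift ::
  "('k::field \<Rightarrow> 'a \<Rightarrow> 'a) \<Rightarrow> ('k \<Rightarrow> 'b \<Rightarrow> 'b) \<Rightarrow> 'a::ab_group_add set \<Rightarrow> 'b::ab_group_add set \<Rightarrow>
   ('k, 'a, 'b) tensor \<Rightarrow> ('a \<Rightarrow> 'b \<Rightarrow> 'w::ab_group_add) \<Rightarrow> 'w"
  where "tensor_lift sA sB A B t g =
    (THE w. \<exists>xs. set xs \<subseteq> A \<times> B \<and> t = (\<Sum>(a, b)\<leftarrow>xs. tensor sA sB a b) \<and> w = (\<Sum>(a, b)\<leftarrow>xs. g a b))"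

definition tensor3 ::
  "('k::field \<Rightarrow> 'a \<Rightarrow> 'a) \<Rightarrow> ('k \<Rightarrow> 'b \<Rightarrow> 'b) \<Rightarrow> ('k \<Rightarrow> 'c \<Rightarrow> 'c) \<Rightarrow>
   'a::ab_group_add \<Rightarrow> 'b::ab_group_add \<Rightarrow> 'c::ab_group_add \<Rightarrow> ('k, 'a, ('k, 'b, 'c) tensor) tensor"
  where "tensor3 sA sB sC a b c = tensor sA tensor_scale a (tensor sB sC b c)"

interpretation tensor: vector_space tensor_scale
  by unfold_locales (auto simp: tensor_scale_def fun_eq_iff algebra_simps)

lemma tensor_add_left: "tensor sA sB (a + a') b = tensor sA sB a b + tensor sA sB a' b"
  by (auto simp: tensor_def fun_eq_iff bilinear_on_def)

lemma tensor_add_right: "tensor sA sB a (b + b') = tensor sA sB a b + tensor sA sB a b'"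
  by (auto simp: tensor_def fun_eq_iff bilinear_on_def)

lemma tensor_scale_left: "tensor sA sB (sA k a) b = tensor_scale k (tensor sA sB a b)"
  by (auto simp: tensor_def fun_eq_iff bilinear_on_def tensor_scale_def)

lemma tensor_scale_right: "tensor sA sB a (sB k b) = tensor_scale k (tensor sA sB a b)"
  by (auto simp: tensor_def fun_eq_iff bilinear_on_def tensor_scale_def)

lemma tensor_space_sum_list:
  assumes "vector_space sA" and A: "module.subspace sA A" and t: "t \<in> tensor_space sA sB A B"
  obtains xs where "set xs \<subseteq> A \<times> B" and "t = (\<Sum>(a, b)\<leftarrow>xs. tensor sA sB a b)"
proof -
  interpret A: vector_space sA by fact
  have "\<exists>xs. set xs \<subseteq> A \<times> B \<and> t = (\<Sum>(a, b)\<leftarrow>xs. tensor sA sB a b)"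
    using t unfolding tensor_space_def
  proof (induction rule: tensor.span_induct_alt)
    case base
    show ?case by (rule exI[of _ "[]"]) simp
  next
    case (step c x y)
    then obtain a b xs where *: "x = tensor sA sB a b" "a \<in> A" "b \<in> B"
      "set xs \<subseteq> A \<times> B" "y = (\<Sum>(a, b)\<leftarrow>xs. tensor sA sB a b)"
      by auto
    show ?case
      by (rule exI[of _ "(sA c a, b) # xs"])
        (use * A in \<open>auto simp: tensor_scale_left A.subspace_scale\<close>)
  qed
  then show thesis using that by blast
qed

lemma linear_projection:
  assumes "vector_space sA" and A: "module.subspace sA A"
  obtains p where "Vector_Spaces.linear sA sA p" "\<And>x. p x \<in> A" "\<And>x. x \<in> A \<Longrightarrow> p x = x"
proof -
  interpret A: vector_space sA by fact
  interpret P: vector_space_pair sA sA by unfold_locales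
  obtain B where B: "B \<subseteq> A" "A.independent B" "A.span B = A"
    using A.basis_exists[of A] A.span_subspace[OF _ _ A] by metis
  let ?p = "P.construct B (\<lambda>x. x)"
  have lin: "Vector_Spaces.linear sA sA ?p" by (rule P.linear_construct[OF B(2)])
  interpret p: Vector_Spaces.linear sA sA ?p by fact
  have "?p x \<in> A" for x
    using P.construct_in_span[OF B(2), of "\<lambda>x. x" x] B(3) by simp
  moreover have "?p x = x" if "x \<in> A" for x
  proof -
    have "x \<in> A.span B" using that B(3) by simp
    then show ?thesis
      by (induction rule: A.span_induct_alt) (auto simp: p.add p.scale p.zero P.construct_basis[OF B(2)])
  qed
  ultimately show thesis using lin that by blast
qed

lemma separating_functional:
  assumes "vector_space (sW :: 'k::field \<Rightarrow> 'w::ab_group_add \<Rightarrow> 'w)" and w: "w \<noteq> 0"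
  obtains l where "Vector_Spaces.linear sW ((*) :: 'k \<Rightarrow> 'k \<Rightarrow> 'k) l" "l w \<noteq> 0"
proof -
  interpret W: vector_space sW by fact
  interpret K: vector_space "(*) :: 'k \<Rightarrow> 'k \<Rightarrow> 'k" by unfold_locales (auto simp: algebra_simps)
  interpret P: vector_space_pair sW "(*) :: 'k \<Rightarrow> 'k \<Rightarrow> 'k" by unfold_locales
  have i: "W.independent {w}" using w by simp
  show thesis
    using that[OF P.linear_construct[OF i, of "\<lambda>_. 1"]] P.construct_basis[OF i, of w "\<lambda>_. 1"] by simp
qed

lemma tensor_lift_sum_list:
  assumes "vector_space sA" "vector_space sB" "vector_space sW"
    and A: "module.subspace sA A" and B: "module.subspace sB B"
    and g: "bilinear_on sA sB sW A B g" and xs: "set xs \<subseteq> A \<times> B"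
  shows "tensor_lift sA sB A B (\<Sum>(a, b)\<leftarrow>xs. tensor sA sB a b) g = (\<Sum>(a, b)\<leftarrow>xs. g a b)"
proof -
  interpret A: vector_space sA by fact
  interpret B: vector_space sB by fact
  interpret W: vector_space sW by fact
  obtain p where p: "Vector_Spaces.linear sA sA p" "\<And>x. p x \<in> A" "\<And>x. x \<in> A \<Longrightarrow> p x = x"
    using linear_projection[OF assms(1) A] by blast
  obtain q where q: "Vector_Spaces.linear sB sB q" "\<And>x. q x \<in> B" "\<And>x. x \<in> B \<Longrightarrow> q x = x"
    using linear_projection[OF assms(2) B] by blast
  interpret p: Vector_Spaces.linear sA sA p by fact
  interpret q: Vector_Spaces.linear sB sB q by fact
  have eval: "(\<Sum>(a, b)\<leftarrow>zs. tensor sA sB a b) \<beta> = (\<Sum>(a, b)\<leftarrow>zs. \<beta> a b)"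
    if "bilinear_on sA sB (*) UNIV UNIV \<beta>" for \<beta> zs
    using that by (induction zs) (auto simp: tensor_def)
  have "w = (\<Sum>(a, b)\<leftarrow>xs. g a b)"
    if ys: "set ys \<subseteq> A \<times> B"
      and eq: "(\<Sum>(a, b)\<leftarrow>xs. tensor sA sB a b) = (\<Sum>(a, b)\<leftarrow>ys. tensor sA sB a b)"
      and w: "w = (\<Sum>(a, b)\<leftarrow>ys. g a b)" for ys w
  proof (rule ccontr)
    assume "w \<noteq> (\<Sum>(a, b)\<leftarrow>xs. g a b)"
    then obtain l where l: "Vector_Spaces.linear sW (*) l" "l (w - (\<Sum>(a, b)\<leftarrow>xs. g a b)) \<noteq> 0"
      using separating_functional[OF assms(3)] by (metis right_minus_eq)
    interpret l: Vector_Spaces.linear sW "(*)" l by fact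
    define \<beta> where "\<beta> a b = l (g (p a) (q b))" for a b
    have "bilinear_on sA sB (*) UNIV UNIV \<beta>"
      using g p(2) q(2)
      by (auto simp: \<beta>_def bilinear_on_def p.add p.scale q.add q.scale l.add l.scale)
    moreover have "l (\<Sum>(a, b)\<leftarrow>zs. g a b) = (\<Sum>(a, b)\<leftarrow>zs. \<beta> a b)" if "set zs \<subseteq> A \<times> B" for zs
      using that by (induction zs) (auto simp: \<beta>_def l.add l.zero p(3) q(3))
    ultimately have "l w = l (\<Sum>(a, b)\<leftarrow>xs. g a b)"
      using eval[of \<beta> xs] eval[of \<beta> ys] eq w xs ys by simp
    then show False using l(2) by (simp add: l.diff)
  qed
  then show ?thesis
    unfolding tensor_lift_def by (intro the_equality) (use xs in blast)+
qed


section \<open>Coalgebras and Hopf algebras\<close>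

text \<open>
  Sweedler notation: for multilinear \<open>g\<close>, \<open>sweedler2 s \<Delta> c (\<lambda>c1 c2. g c1 c2)\<close> is the sum that is
  customarily written \<open>g c1 c2\<close> with \<open>\<Delta> c\<close> the sum of the \<open>c1 \<otimes> c2\<close>; \<open>sweedler3\<close> is the analogue for
  the iterated comultiplication. Likewise \<open>tensor_lift sH sM UNIV M (\<rho> m) (\<lambda>x n. g x n)\<close> is the sum of
  the \<open>g x n\<close> where \<open>x\<close> and \<open>n\<close> are the components of the coaction \<open>\<rho> m\<close>.
\<close>

definition sweedler2 ::
  "('k::field \<Rightarrow> 'c \<Rightarrow> 'c) \<Rightarrow> ('c::ab_group_add \<Rightarrow> ('k, 'c, 'c) tensor) \<Rightarrow>
   'c \<Rightarrow> ('c \<Rightarrow> 'c \<Rightarrow> 'w::ab_group_add) \<Rightarrow> 'w"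
  where "sweedler2 s \<Delta> c g = tensor_lift s s UNIV UNIV (\<Delta> c) g"

definition sweedler3 ::
  "('k::field \<Rightarrow> 'c \<Rightarrow> 'c) \<Rightarrow> ('c::ab_group_add \<Rightarrow> ('k, 'c, 'c) tensor) \<Rightarrow>
   'c \<Rightarrow> ('c \<Rightarrow> 'c \<Rightarrow> 'c \<Rightarrow> 'w::ab_group_add) \<Rightarrow> 'w"
  where "sweedler3 s \<Delta> c g = sweedler2 s \<Delta> c (\<lambda>c1 d. sweedler2 s \<Delta> d (\<lambda>c2 c3. g c1 c2 c3))"

locale k_algebra = vector_space scale
  for scale :: "'k::field \<Rightarrow> 'a::ring_1 \<Rightarrow> 'a" +
  assumes scale_mult_left: "scale k x * y = scale k (x * y)"
    and scale_mult_right: "x * scale k y = scale k (x * y)"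

locale coalgebra = vector_space scale
  for scale :: "'k::field \<Rightarrow> 'c::ab_group_add \<Rightarrow> 'c" +
  fixes \<Delta> :: "'c \<Rightarrow> ('k, 'c, 'c) tensor" and \<epsilon> :: "'c \<Rightarrow> 'k"
  assumes comult_linear: "Vector_Spaces.linear scale tensor_scale \<Delta>"
    and comult_mem: "\<Delta> c \<in> tensor_space scale scale UNIV UNIV"
    and counit_linear: "Vector_Spaces.linear scale (*) \<epsilon>"
    and coassoc:
      "sweedler2 scale \<Delta> c (\<lambda>x y. sweedler2 scale \<Delta> x (\<lambda>a b. tensor3 scale scale scale a b y)) =
       sweedler2 scale \<Delta> c (\<lambda>x y. sweedler2 scale \<Delta> y (\<lambda>a b. tensor3 scale scale scale x a b))"
    and counit_left: "sweedler2 scale \<Delta> c (\<lambda>x y. scale (\<epsilon> x) y) = c"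
    and counit_right: "sweedler2 scale \<Delta> c (\<lambda>x y. scale (\<epsilon> y) x) = c"

locale bialgebra = k_algebra scale + coalgebra scale \<Delta> \<epsilon>
  for scale :: "'k::field \<Rightarrow> 'h::ring_1 \<Rightarrow> 'h" and \<Delta> \<epsilon> +
  assumes comult_mult: "\<Delta> (x * y) =
      sweedler2 scale \<Delta> x (\<lambda>x1 x2. sweedler2 scale \<Delta> y (\<lambda>y1 y2. tensor scale scale (x1 * y1) (x2 * y2)))"
    and comult_one: "\<Delta> 1 = tensor scale scale 1 1"
    and counit_mult: "\<epsilon> (x * y) = \<epsilon> x * \<epsilon> y"
    and counit_one: "\<epsilon> 1 = 1"

text \<open>Invertibility of the antipode is a standing assumption and hence part of the definition.\<close>

locale hopf_algebra = bialgebra scale \<Delta> \<epsilon>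
  for scale :: "'k::field \<Rightarrow> 'h::ring_1 \<Rightarrow> 'h" and \<Delta> \<epsilon> +
  fixes S :: "'h \<Rightarrow> 'h"
  assumes antipode_linear: "Vector_Spaces.linear scale scale S"
    and antipode_left: "sweedler2 scale \<Delta> h (\<lambda>h1 h2. S h1 * h2) = scale (\<epsilon> h) 1"
    and antipode_right: "sweedler2 scale \<Delta> h (\<lambda>h1 h2. h1 * S h2) = scale (\<epsilon> h) 1"
    and antipode_bij: "bij S"

definition coalgebra_map ::
  "('k::field \<Rightarrow> 'c \<Rightarrow> 'c) \<Rightarrow> ('c::ab_group_add \<Rightarrow> ('k, 'c, 'c) tensor) \<Rightarrow> ('c \<Rightarrow> 'k) \<Rightarrow>
   ('k \<Rightarrow> 'd \<Rightarrow> 'd) \<Rightarrow> ('d::ab_group_add \<Rightarrow> ('k, 'd, 'd) tensor) \<Rightarrow> ('d \<Rightarrow> 'k) \<Rightarrow> ('c \<Rightarrow> 'd) \<Rightarrow> bool"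
  where "coalgebra_map sC \<Delta>C \<epsilon>C sD \<Delta>D \<epsilon>D f \<longleftrightarrow>
    Vector_Spaces.linear sC sD f \<and>
    (\<forall>c. \<Delta>D (f c) = sweedler2 sC \<Delta>C c (\<lambda>c1 c2. tensor sD sD (f c1) (f c2))) \<and>
    (\<forall>c. \<epsilon>D (f c) = \<epsilon>C c)"

definition convolution_inverse ::
  "('k::field \<Rightarrow> 'c \<Rightarrow> 'c) \<Rightarrow> ('c::ab_group_add \<Rightarrow> ('k, 'c, 'c) tensor) \<Rightarrow> ('c \<Rightarrow> 'k) \<Rightarrow>
   ('k \<Rightarrow> 'a \<Rightarrow> 'a) \<Rightarrow> ('c \<Rightarrow> 'a::ring_1) \<Rightarrow> ('c \<Rightarrow> 'a) \<Rightarrow> bool"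
  where "convolution_inverse sC \<Delta>C \<epsilon>C sA f g \<longleftrightarrow>
    Vector_Spaces.linear sC sA g \<and>
    (\<forall>c. sweedler2 sC \<Delta>C c (\<lambda>c1 c2. f c1 * g c2) = sA (\<epsilon>C c) 1) \<and>
    (\<forall>c. sweedler2 sC \<Delta>C c (\<lambda>c1 c2. g c1 * f c2) = sA (\<epsilon>C c) 1)"


section \<open>Modules, comodules and anti Yetter-Drinfeld modules\<close>

text \<open>
  The underlying space of a module or comodule is a subspace \<open>M\<close> of an ambient space; the behaviour
  of the structure maps outside \<open>M\<close> is irrelevant.
\<close>

locale right_module_on = A: k_algebra sA + V: vector_space sM
  for sA :: "'k::field \<Rightarrow> 'a::ring_1 \<Rightarrow> 'a" and sM :: "'k \<Rightarrow> 'm::ab_group_add \<Rightarrow> 'm" +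
  fixes M :: "'m set" and act :: "'m \<Rightarrow> 'a \<Rightarrow> 'm"
  assumes module_subspace: "V.subspace M"
    and act_mem: "m \<in> M \<Longrightarrow> act m a \<in> M"
    and act_bilinear: "bilinear_on sM sA sM M UNIV act"
    and act_one: "m \<in> M \<Longrightarrow> act m 1 = m"
    and act_mult: "m \<in> M \<Longrightarrow> act m (a * b) = act (act m a) b"

locale left_comodule_on = C: coalgebra sC \<Delta>C \<epsilon>C + V: vector_space sM
  for sC :: "'k::field \<Rightarrow> 'c::ab_group_add \<Rightarrow> 'c" and \<Delta>C \<epsilon>C
    and sM :: "'k \<Rightarrow> 'm::ab_group_add \<Rightarrow> 'm" +
  fixes M :: "'m set" and \<rho> :: "'m \<Rightarrow> ('k, 'c, 'm) tensor"
  assumes comodule_subspace: "V.subspace M"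
    and coact_mem: "m \<in> M \<Longrightarrow> \<rho> m \<in> tensor_space sC sM UNIV M"
    and coact_add: "m \<in> M \<Longrightarrow> n \<in> M \<Longrightarrow> \<rho> (m + n) = \<rho> m + \<rho> n"
    and coact_scale: "m \<in> M \<Longrightarrow> \<rho> (sM k m) = tensor_scale k (\<rho> m)"
    and coact_coassoc: "m \<in> M \<Longrightarrow>
      tensor_lift sC sM UNIV M (\<rho> m) (\<lambda>x n. sweedler2 sC \<Delta>C x (\<lambda>a b. tensor3 sC sC sM a b n)) =
      tensor_lift sC sM UNIV M (\<rho> m) (\<lambda>x n. tensor_lift sC sM UNIV M (\<rho> n) (\<lambda>a p. tensor3 sC sC sM x a p))"
    and coact_counit: "m \<in> M \<Longrightarrow> tensor_lift sC sM UNIV M (\<rho> m) (\<lambda>x n. sM (\<epsilon>C x) n) = m"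

locale right_left_anti_yetter_drinfeld_module =
  H: hopf_algebra sH \<Delta>H \<epsilon>H S + right_module_on sH sM M act + left_comodule_on sH \<Delta>H \<epsilon>H sM M \<rho>
  for sH :: "'k::field \<Rightarrow> 'h::ring_1 \<Rightarrow> 'h" and \<Delta>H \<epsilon>H S
    and sM :: "'k \<Rightarrow> 'm::ab_group_add \<Rightarrow> 'm" and M act \<rho> +
  assumes anti_yetter_drinfeld: "m \<in> M \<Longrightarrow> \<rho> (act m h) =
    tensor_lift sH sM UNIV M (\<rho> m)
      (\<lambda>x n. sweedler3 sH \<Delta>H h (\<lambda>h1 h2 h3. tensor sH sM (S h3 * x * h1) (act n h2)))"

definition stable_on ::
  "('k::field \<Rightarrow> 'h \<Rightarrow> 'h) \<Rightarrow> ('k \<Rightarrow> 'm \<Rightarrow> 'm) \<Rightarrow> 'm set \<Rightarrow> ('m \<Rightarrow> 'h \<Rightarrow> 'm) \<Rightarrow>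
   ('m::ab_group_add \<Rightarrow> ('k, 'h::ab_group_add, 'm) tensor) \<Rightarrow> bool"
  where "stable_on sH sM M act \<rho> \<longleftrightarrow>
    (\<forall>m\<in>M. tensor_lift sH sM UNIV M (\<rho> m) (\<lambda>x n. act n x) = m)"


section \<open>Module coalgebras\<close>

locale right_module_coalgebra =
  H: bialgebra sH \<Delta>H \<epsilon>H + C: coalgebra sC \<Delta>C \<epsilon>C + right_module_on sH sC UNIV act
  for sH :: "'k::field \<Rightarrow> 'h::ring_1 \<Rightarrow> 'h" and \<Delta>H \<epsilon>H
    and sC :: "'k \<Rightarrow> 'c::ab_group_add \<Rightarrow> 'c" and \<Delta>C \<epsilon>C and act :: "'c \<Rightarrow> 'h \<Rightarrow> 'c" +
  assumes comult_act: "\<Delta>C (act c h) =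
      sweedler2 sC \<Delta>C c (\<lambda>c1 c2. sweedler2 sH \<Delta>H h (\<lambda>h1 h2. tensor sC sC (act c1 h1) (act c2 h2)))"
    and counit_act: "\<epsilon>C (act c h) = \<epsilon>C c * \<epsilon>H h"

definition total_cointegral ::
  "('k::field \<Rightarrow> 'h \<Rightarrow> 'h) \<Rightarrow> ('h::ring_1 \<Rightarrow> 'k) \<Rightarrow> ('k \<Rightarrow> 'c \<Rightarrow> 'c) \<Rightarrow> ('c::ab_group_add \<Rightarrow> 'k) \<Rightarrow>
   ('c \<Rightarrow> 'h \<Rightarrow> 'c) \<Rightarrow> ('c \<Rightarrow> 'h) \<Rightarrow> bool"
  where "total_cointegral sH \<epsilon>H sC \<epsilon>C act f \<longleftrightarrow>
    Vector_Spaces.linear sC sH f \<and> (\<forall>c. \<epsilon>H (f c) = \<epsilon>C c) \<and> (\<forall>c h. f (act c h) = f c * h)"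

text \<open>The quotient space by a subspace \<open>I\<close>, its elements being cosets, and its algebraic dual.\<close>

definition coset :: "'c::ab_group_add set \<Rightarrow> 'c \<Rightarrow> 'c set"
  where "coset I c = (\<lambda>i. c + i) ` I"

definition quotient_space :: "'c::ab_group_add set \<Rightarrow> 'c set set"
  where "quotient_space I = range (coset I)"

definition quotient_add :: "'c::ab_group_add set \<Rightarrow> 'c set \<Rightarrow> 'c set \<Rightarrow> 'c set"
  where "quotient_add I X Y = (\<Union>x\<in>X. \<Union>y\<in>Y. coset I (x + y))"

definition quotient_scale :: "('k \<Rightarrow> 'c \<Rightarrow> 'c) \<Rightarrow> 'c::ab_group_add set \<Rightarrow> 'k \<Rightarrow> 'c set \<Rightarrow> 'c set"
  where "quotient_scale s I k X = (\<Union>x\<in>X. coset I (s k x))"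

definition quotient_dual ::
  "('k::field \<Rightarrow> 'c \<Rightarrow> 'c) \<Rightarrow> 'c::ab_group_add set \<Rightarrow> ('c set \<Rightarrow> 'k) set"
  where "quotient_dual s I = {\<phi>.
    (\<forall>X\<in>quotient_space I. \<forall>Y\<in>quotient_space I. \<phi> (quotient_add I X Y) = \<phi> X + \<phi> Y) \<and>
    (\<forall>k. \<forall>X\<in>quotient_space I. \<phi> (quotient_scale s I k X) = k * \<phi> X)}"

text \<open>The coideal \<open>I\<close> with \<open>D = C / I\<close>.\<close>

definition augmentation_coideal ::
  "('h \<Rightarrow> 'k::field) \<Rightarrow> ('k \<Rightarrow> 'c \<Rightarrow> 'c) \<Rightarrow> ('c::ab_group_add \<Rightarrow> 'h \<Rightarrow> 'c) \<Rightarrow> 'c set"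
  where "augmentation_coideal \<epsilon>H sC act = module.span sC {act c h - sC (\<epsilon>H h) c |c h. True}"

definition C_upper_D ::
  "('h \<Rightarrow> 'k::field) \<Rightarrow> ('k \<Rightarrow> 'c \<Rightarrow> 'c) \<Rightarrow> ('c::ab_group_add \<Rightarrow> ('k, 'c, 'c) tensor) \<Rightarrow>
   ('c \<Rightarrow> 'h \<Rightarrow> 'c) \<Rightarrow> 'c set"
  where "C_upper_D \<epsilon>H sC \<Delta>C act =
    (let I = augmentation_coideal \<epsilon>H sC act; \<pi> = coset I
     in {c. \<forall>\<phi>\<in>quotient_dual sC I.
          sweedler2 sC \<Delta>C c (\<lambda>c1 c2. sC (\<phi> (\<pi> c2)) c1) =
          sweedler2 sC \<Delta>C c (\<lambda>c1 c2. sC (\<phi> (\<pi> c1)) c2)})"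

definition cointegral_coaction ::
  "('k::field \<Rightarrow> 'h \<Rightarrow> 'h) \<Rightarrow> ('k \<Rightarrow> 'c \<Rightarrow> 'c) \<Rightarrow> ('c::ab_group_add \<Rightarrow> ('k, 'c, 'c) tensor) \<Rightarrow>
   ('c \<Rightarrow> 'h::ring_1) \<Rightarrow> ('c \<Rightarrow> 'h) \<Rightarrow> 'c \<Rightarrow> ('k, 'h, 'c) tensor"
  where "cointegral_coaction sH sC \<Delta>C f finv c =
    sweedler3 sC \<Delta>C c (\<lambda>c1 c2 c3. tensor sH sC (finv c3 * f c1) c2)"

end

theory Submission
  imports Defs
begin

text \<open>
  Since \<open>f\<close> respects coproducts, the antipode identities for \<open>f c\<close> say that \<open>S \<circ> f\<close> is the convolution
  inverse of \<open>f\<close>. As \<open>S\<close> reverses both products and coproducts,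
  \<open>\<rho> c = S (f c3) f c1 \<otimes> c2\<close> is coassociative and counital on all of \<open>C\<close>, and
  \<open>f (c h) = (f c) h\<close> turns \<open>\<rho> (c h)\<close> into the expression that the anti Yetter-Drinfeld condition
  prescribes. Likewise \<open>C\<^sup>D\<close> is stable under the action because functionals on \<open>D\<close> do not see the
  action of \<open>H\<close>. Stability is the hypothesis of the last claim read through the definition of \<open>\<rho>\<close>.

  The substance is that \<open>\<rho>\<close> maps \<open>C\<^sup>D\<close> into \<open>H \<otimes> C\<^sup>D\<close>. Pulling functionals back along the
  projection, \<open>C\<^sup>D\<close> consists of the \<open>c\<close> with \<open>c1 \<psi>(c2) = c2 \<psi>(c1)\<close> for all linear \<open>\<psi>\<close> with
  \<open>\<psi>(c h) = \<epsilon>(h) \<psi>(c)\<close>. Expressing vectors in coordinates, the same exchange \<open>c1 \<otimes> L c2 = c2 \<otimes> L c1\<close>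
  holds for every linear map \<open>L\<close>, into any vector space, that satisfies \<open>L (c h) = \<epsilon>(h) L c\<close>
  (lemma \<open>C_upper_D_exchange\<close>). Given \<open>\<psi>\<close>, the map \<open>L b = \<psi>(b2) f b1 S (f b3)\<close> has this property. Now let
  \<open>\<Phi>(a, w) = S (f a3) w f a1 \<otimes> a2\<close>. Cancelling adjacent factors \<open>S (f x) f y\<close> gives
  \<open>\<Phi>(c1, L c2) = S (f c3) f c4 S (f c6) f c1 \<otimes> c2 \<psi>(c5) = S (f c4) f c1 \<otimes> c2 \<psi>(c3)\<close> and
  \<open>\<Phi>(c2, L c1) = S (f c6) f c1 S (f c3) f c4 \<otimes> c5 \<psi>(c2) = S (f c4) f c1 \<otimes> c3 \<psi>(c2)\<close>.
  For \<open>c\<close> in \<open>C\<^sup>D\<close> the left-hand sides agree, and equality of the right-hand sides says exactly that the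
  second tensor factors of \<open>\<rho> c\<close> satisfy the condition for \<open>\<psi>\<close>. To work with elements of \<open>C\<close> instead of
  tensors, the first factor is contracted with an arbitrary functional \<open>l\<close> (lemma \<open>slice_mem_C_upper_D\<close>);
  a tensor all of whose slices lie in a subspace belongs to the tensor product with that subspace
  (lemma \<open>mem_tensor_space_if_slices_mem\<close>).
\<close>


section \<open>Linear maps and finite coordinates\<close>

abbreviation lin where "lin \<equiv> Vector_Spaces.linear"

text \<open>
  Stated as linearity in each argument, so that multilinearity of nested Sweedler sums is
  established argument by argument, by composition rules whose head symbol determines which one applies.
  As in \<^const>\<open>Vector_Spaces.linear\<close>, being a vector space is part of the statement for all three
  scalar multiplications.
\<close>

definition bilin where
  "bilin s1 s2 t g \<longleftrightarrow> (\<forall>b. lin s1 t (\<lambda>a. g a b)) \<and> (\<forall>a. lin s2 t (\<lambda>b. g a b))"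

lemma linD:
  assumes "lin s t f"
  shows "vector_space s" "vector_space t" "f (x + y) = f x + f y" "f (s k x) = t k (f x)" "f 0 = 0"
proof -
  interpret Vector_Spaces.linear s t f by fact
  show "vector_space s" "vector_space t" by unfold_locales
  show "f (x + y) = f x + f y" "f (s k x) = t k (f x)" "f 0 = 0" by (rule add scale zero)+
qed

lemma linI:
  assumes "vector_space s" "vector_space t"
    and "\<And>x y. f (x + y) = f x + f y" "\<And>k x. f (s k x) = t k (f x)"
  shows "lin s t f"
  using assms by (simp add: Vector_Spaces.linear_iff)

lemma lin_sum: "lin s t f \<Longrightarrow> f (\<Sum>x\<in>X. h x) = (\<Sum>x\<in>X. f (h x))"
  by (induction X rule: infinite_finite_induct) (simp_all add: linD)

lemma lin_sum_list: "lin s t f \<Longrightarrow> f (\<Sum>x\<leftarrow>xs. h x) = (\<Sum>x\<leftarrow>xs. f (h x))"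
  by (induction xs) (simp_all add: linD)

lemma lin_sum_list_body:
  assumes "\<And>x. lin s t (\<lambda>y. g y x)"
  shows "lin s t (\<lambda>y. \<Sum>x\<leftarrow>xs. g y x)"
proof -
  interpret vector_space t using assms by (rule linD)
  show ?thesis
  proof (rule linI)
    show "(\<Sum>x\<leftarrow>xs. g (y + z) x) = (\<Sum>x\<leftarrow>xs. g y x) + (\<Sum>x\<leftarrow>xs. g z x)" for y z
      by (simp add: linD(3)[OF assms] sum_list_addf)
    show "(\<Sum>x\<leftarrow>xs. g (s k y) x) = t k (\<Sum>x\<leftarrow>xs. g y x)" for k y
      by (induction xs) (simp_all add: linD(4)[OF assms] scale_right_distrib)
  qed (rule linD(1,2)[OF assms])+
qed

lemma lin_ident: "vector_space s \<Longrightarrow> lin s s (\<lambda>x. x)"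
  by (rule linI) auto

lemma lin_comp: "lin u t p \<Longrightarrow> lin s u F \<Longrightarrow> lin s t (\<lambda>x. p (F x))"
  by (rule linI) (simp_all add: linD)

lemma lin_scale_right:
  assumes "lin s t F"
  shows "lin s t (\<lambda>x. t k (F x))"
proof -
  interpret vector_space t using assms by (rule linD)
  show ?thesis
    using assms by (intro linI) (simp_all add: linD scale_right_distrib mult.commute)
qed

lemma vector_space_field: "vector_space ((*) :: 'k::field \<Rightarrow> 'k \<Rightarrow> 'k)"
  by unfold_locales (auto simp: algebra_simps)

lemma lin_scale_left:
  assumes "vector_space t" "lin s (*) F"
  shows "lin s t (\<lambda>x. t (F x) b)"
proof -
  interpret vector_space t by fact
  show ?thesis using assms by (intro linI) (simp_all add: linD scale_left_distrib)
qed

lemma lin_field_mult_left: "lin s (*) F \<Longrightarrow> lin s (*) (\<lambda>x. F x * (b::'k::field))"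
  by (rule linI) (auto simp: linD algebra_simps)

lemma lin_field_mult_right: "lin s (*) F \<Longrightarrow> lin s (*) (\<lambda>x. (b::'k::field) * F x)"
  by (rule linI) (auto simp: linD algebra_simps)

lemma lin_tensor_left: "lin s sA F \<Longrightarrow> lin s tensor_scale (\<lambda>x. tensor sA sB (F x) b)"
  by (rule linI) (auto simp: linD tensor_add_left tensor_scale_left tensor.vector_space_axioms)

lemma lin_tensor_right: "lin s sB F \<Longrightarrow> lin s tensor_scale (\<lambda>x. tensor sA sB a (F x))"
  by (rule linI) (auto simp: linD tensor_add_right tensor_scale_right tensor.vector_space_axioms)

lemma lin_tensor3_1: "lin s sA F \<Longrightarrow> lin s tensor_scale (\<lambda>x. tensor3 sA sB sC (F x) b c)"
  unfolding tensor3_def by (rule lin_tensor_left)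

lemma lin_tensor3_2: "lin s sB F \<Longrightarrow> lin s tensor_scale (\<lambda>x. tensor3 sA sB sC a (F x) c)"
  unfolding tensor3_def by (intro lin_tensor_right lin_tensor_left)

lemma lin_tensor3_3: "lin s sC F \<Longrightarrow> lin s tensor_scale (\<lambda>x. tensor3 sA sB sC a b (F x))"
  unfolding tensor3_def by (intro lin_tensor_right)

context k_algebra
begin

lemma lin_mult_left: "lin s scale F \<Longrightarrow> lin s scale (\<lambda>x. F x * b)"
  by (rule linI) (auto simp: linD distrib_right scale_mult_left vector_space_axioms)

lemma lin_mult_right: "lin s scale F \<Longrightarrow> lin s scale (\<lambda>x. b * F x)"
  by (rule linI) (auto simp: linD distrib_left scale_mult_right vector_space_axioms)

end

lemma bilinI:
  assumes "\<And>b. lin s1 t (\<lambda>a. g a b)" "\<And>a. lin s2 t (\<lambda>b. g a b)"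
  shows "bilin s1 s2 t g"
  using assms by (simp add: bilin_def)

lemma bilinD:
  assumes "bilin s1 s2 t g"
  shows "lin s1 t (\<lambda>a. g a b)" "lin s2 t (\<lambda>b. g a b)"
  using assms by (auto simp: bilin_def)

lemma bilin_imp_bilinear_on: "bilin s1 s2 t g \<Longrightarrow> bilinear_on s1 s2 t A B g"
  unfolding bilin_def bilinear_on_def by (auto dest: linD(3,4))

lemma bilinear_on_imp_bilin:
  assumes "vector_space s1" "vector_space s2" "vector_space t" "bilinear_on s1 s2 t UNIV UNIV g"
  shows "bilin s1 s2 t g"
  using assms by (auto simp: bilinear_on_def intro!: bilinI linI)

text \<open>
  Coordinates with respect to a basis of the whole space are globally defined functionals; only finitely
  many of them are nonzero on a finite set.
\<close>

lemma finite_coordinates: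
  fixes s :: "'k::field \<Rightarrow> 'v::ab_group_add \<Rightarrow> 'v"
  assumes "vector_space s" and "finite F"
  obtains B :: "'v set" and l :: "'v \<Rightarrow> 'v \<Rightarrow> 'k" where "finite B" "\<And>b. lin s (*) (l b)"
    "\<And>v. v \<in> F \<Longrightarrow> v = (\<Sum>b\<in>B. s (l b v) b)"
proof -
  interpret vector_space s by fact
  obtain B0 where B0: "independent B0" "span B0 = UNIV"
    using basis_exists[of UNIV] by (metis top.extremum_uniqueI span_mono span_UNIV top_greatest)
  define B where "B = (\<Union>v\<in>F. {b. representation B0 v b \<noteq> 0})"
  have fin: "finite B" unfolding B_def using assms(2) by (auto intro: finite_representation)
  show thesis
  proof (rule that[OF fin, of "\<lambda>b v. representation B0 v b"])
    show "lin s (*) (\<lambda>v. representation B0 v b)" for b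
      by (rule linI) (use B0 vector_space_axioms vector_space_field in
          \<open>auto simp: representation_add representation_scale\<close>)
    show "v = (\<Sum>b\<in>B. s (representation B0 v b) b)" if "v \<in> F" for v
    proof -
      have "v = (\<Sum>b | representation B0 v b \<noteq> 0. s (representation B0 v b) b)"
        using B0 sum_nonzero_representation_eq[of B0 v] by simp
      also have "\<dots> = (\<Sum>b\<in>B. s (representation B0 v b) b)"
        by (rule sum.mono_neutral_left) (use fin that in \<open>auto simp: B_def\<close>)
      finally show ?thesis .
    qed
  qed
qed

section \<open>Maps out of tensor products\<close>

lemma tensor_space_UNIV_sum_list:
  assumes "vector_space sA" "t \<in> tensor_space sA sB UNIV B"
  obtains xs where "set xs \<subseteq> UNIV \<times> B" "t = (\<Sum>(a, b)\<leftarrow>xs. tensor sA sB a b)"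
proof -
  interpret A: vector_space sA by fact
  show thesis using tensor_space_sum_list[OF assms(1) A.subspace_UNIV assms(2)] that by blast
qed

lemma tensor_mem: "a \<in> A \<Longrightarrow> b \<in> B \<Longrightarrow> tensor sA sB a b \<in> tensor_space sA sB A B"
  unfolding tensor_space_def by (rule tensor.span_base) auto

lemma subspace_tensor_space: "tensor.subspace (tensor_space sA sB A B)"
  unfolding tensor_space_def by (rule tensor.subspace_span)

lemma sum_list_mem_tensor_space:
  "(\<And>x. x \<in> set xs \<Longrightarrow> h x \<in> tensor_space sA sB A B) \<Longrightarrow> (\<Sum>x\<leftarrow>xs. h x) \<in> tensor_space sA sB A B"
  by (induction xs)
    (auto intro: tensor.subspace_add[OF subspace_tensor_space] tensor.subspace_0[OF subspace_tensor_space])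

context
  fixes sA :: "'k::field \<Rightarrow> 'a::ab_group_add \<Rightarrow> 'a" and sB :: "'k \<Rightarrow> 'b::ab_group_add \<Rightarrow> 'b"
    and sW :: "'k \<Rightarrow> 'w::ab_group_add \<Rightarrow> 'w" and B :: "'b set" and g
  assumes vs: "vector_space sA" "vector_space sB" "vector_space sW"
    and B: "module.subspace sB B" and g: "bilinear_on sA sB sW UNIV B g"
begin

interpretation A: vector_space sA by (rule vs)
interpretation B: vector_space sB by (rule vs)
interpretation W: vector_space sW by (rule vs)

lemma tensor_lift_list:
  "set xs \<subseteq> UNIV \<times> B \<Longrightarrow>
    tensor_lift sA sB UNIV B (\<Sum>(a, b)\<leftarrow>xs. tensor sA sB a b) g = (\<Sum>(a, b)\<leftarrow>xs. g a b)"
  by (rule tensor_lift_sum_list[OF vs _ B g]) auto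

lemma tensor_lift_tensor: "b \<in> B \<Longrightarrow> tensor_lift sA sB UNIV B (tensor sA sB a b) g = g a b"
  using tensor_lift_list[of "[(a, b)]"] by simp

lemma tensor_lift_add:
  assumes "t \<in> tensor_space sA sB UNIV B" "u \<in> tensor_space sA sB UNIV B"
  shows "tensor_lift sA sB UNIV B (t + u) g = tensor_lift sA sB UNIV B t g + tensor_lift sA sB UNIV B u g"
proof -
  obtain xs ys where x: "set xs \<subseteq> UNIV \<times> B" "t = (\<Sum>(a, b)\<leftarrow>xs. tensor sA sB a b)"
    and y: "set ys \<subseteq> UNIV \<times> B" "u = (\<Sum>(a, b)\<leftarrow>ys. tensor sA sB a b)"
    using tensor_space_UNIV_sum_list[OF vs(1)] assms by metis
  show ?thesis
    using tensor_lift_list[of "xs @ ys"] tensor_lift_list[OF x(1)] tensor_lift_list[OF y(1)] x y by simp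
qed

lemma tensor_lift_scale:
  assumes "t \<in> tensor_space sA sB UNIV B"
  shows "tensor_lift sA sB UNIV B (tensor_scale k t) g = sW k (tensor_lift sA sB UNIV B t g)"
proof -
  obtain xs where x: "set xs \<subseteq> UNIV \<times> B" "t = (\<Sum>(a, b)\<leftarrow>xs. tensor sA sB a b)"
    using tensor_space_UNIV_sum_list[OF vs(1)] assms by metis
  let ?ys = "map (\<lambda>(a, b). (sA k a, b)) xs"
  \<comment> \<open>Tensors are functions; their sums must not be evaluated pointwise.\<close>
  have "tensor_scale k t = (\<Sum>(a, b)\<leftarrow>?ys. tensor sA sB a b)"
    unfolding x(2) by (induction xs)
      (auto simp: tensor_scale_left tensor.scale_right_distrib simp del: plus_fun_apply zero_fun_apply)
  moreover have "set ?ys \<subseteq> UNIV \<times> B" using x(1) by auto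
  moreover have "(\<Sum>(a, b)\<leftarrow>?ys. g a b) = sW k (\<Sum>(a, b)\<leftarrow>xs. g a b)"
    using x(1) g by (induction xs) (auto simp: W.scale_right_distrib bilinear_on_def)
  ultimately show ?thesis using tensor_lift_list[of ?ys] tensor_lift_list[OF x(1)] x(2) by simp
qed

lemma tensor_lift_zero: "tensor_lift sA sB UNIV B 0 g = 0"
  using tensor_lift_list[of "[]"] by simp

lemma tensor_lift_sum:
  assumes "\<And>x. x \<in> set xs \<Longrightarrow> h x \<in> tensor_space sA sB UNIV B"
  shows "tensor_lift sA sB UNIV B (\<Sum>x\<leftarrow>xs. h x) g = (\<Sum>x\<leftarrow>xs. tensor_lift sA sB UNIV B (h x) g)"
  using assms
  by (induction xs) (auto simp: tensor_lift_zero tensor_lift_add sum_list_mem_tensor_space)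

end

text \<open>
  Replaces a map that is only known on the subspace by one that is bilinear everywhere, and thereby
  removes the subspace from the computation of the lift.
\<close>

lemma tensor_lift_restrict:
  assumes vs: "vector_space sA" "vector_space sB" and "module.subspace sB B"
    and t: "t \<in> tensor_space sA sB UNIV B"
    and g': "bilin sA sB sW g'" and eq: "\<And>a b. b \<in> B \<Longrightarrow> g a b = g' a b"
  shows "tensor_lift sA sB UNIV B t g = tensor_lift sA sB UNIV UNIV t g'"
proof -
  interpret B: vector_space sB by fact
  have W: "vector_space sW" using g' by (auto dest: bilinD linD(2))
  obtain xs where x: "set xs \<subseteq> UNIV \<times> B" "t = (\<Sum>(a, b)\<leftarrow>xs. tensor sA sB a b)"
    using tensor_space_UNIV_sum_list[OF vs(1) t] by metis
  have g: "bilinear_on sA sB sW UNIV B g"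
    using bilin_imp_bilinear_on[OF g', of UNIV B] B.subspace_add[OF assms(3)]
      B.subspace_scale[OF assms(3)] eq by (simp add: bilinear_on_def)
  have "tensor_lift sA sB UNIV B t g = (\<Sum>(a, b)\<leftarrow>xs. g a b)"
    unfolding x(2) by (rule tensor_lift_list[OF vs W assms(3) g x(1)])
  also have "\<dots> = (\<Sum>(a, b)\<leftarrow>xs. g' a b)"
    by (rule arg_cong[where f = sum_list], rule map_cong) (use x(1) eq in auto)
  also have "\<dots> = tensor_lift sA sB UNIV UNIV t g'"
    unfolding x(2) by (rule tensor_lift_list[OF vs W B.subspace_UNIV bilin_imp_bilinear_on[OF g'], symmetric]) auto
  finally show ?thesis .
qed

text \<open>
  Expand the first factors in finitely many coordinates \<open>l e\<close>: then \<open>t = \<Sum> e \<otimes> t\<^sub>e\<close>, and the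
  coefficient \<open>t\<^sub>e\<close> is the slice of \<open>t\<close> along \<open>l e\<close>.
\<close>

lemma mem_tensor_space_if_slices_mem:
  assumes vs: "vector_space sA" "vector_space sB"
    and t: "t \<in> tensor_space sA sB UNIV UNIV"
    and slices: "\<And>l. lin sA (*) l \<Longrightarrow> tensor_lift sA sB UNIV UNIV t (\<lambda>a b. sB (l a) b) \<in> M"
  shows "t \<in> tensor_space sA sB UNIV M"
proof -
  interpret A: vector_space sA by fact
  interpret B: vector_space sB by fact
  obtain xs where x: "t = (\<Sum>(a, b)\<leftarrow>xs. tensor sA sB a b)"
    using tensor_space_UNIV_sum_list[OF vs(1) t] by metis
  obtain F l where F: "finite F" "\<And>b. lin sA (*) (l b)"
    "\<And>v. v \<in> set (map fst xs) \<Longrightarrow> v = (\<Sum>b\<in>F. sA (l b v) b)"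
    using finite_coordinates[OF vs(1), of "set (map fst xs)"] by auto
  have lift: "tensor_lift sA sB UNIV UNIV t (\<lambda>a b. sB (l e a) b) = (\<Sum>(a, b)\<leftarrow>xs. sB (l e a) b)" for e
    unfolding x
    by (rule tensor_lift_list[OF vs vs(2) B.subspace_UNIV])
      (auto intro!: bilin_imp_bilinear_on bilinI lin_scale_left lin_scale_right lin_ident vs F(2))
  have pure: "tensor sA sB a b = (\<Sum>e\<in>F. tensor sA sB e (sB (l e a) b))" if "(a, b) \<in> set xs" for a b
  proof -
    have lin: "lin sA tensor_scale (\<lambda>x. tensor sA sB x b)" by (intro lin_tensor_left lin_ident vs)
    have a: "a = (\<Sum>e\<in>F. sA (l e a) e)" using that by (intro F(3)) force
    have "tensor sA sB a b = (\<Sum>e\<in>F. tensor sA sB (sA (l e a) e) b)"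
      by (subst a) (rule lin_sum[OF lin])
    then show ?thesis by (simp add: tensor_scale_left tensor_scale_right)
  qed
  have "t = (\<Sum>(a, b)\<leftarrow>xs. \<Sum>e\<in>F. tensor sA sB e (sB (l e a) b))"
    unfolding x by (rule arg_cong[where f = sum_list], rule map_cong) (use pure in auto)
  \<comment> \<open>Tensors are functions; their sums must not be evaluated pointwise.\<close>
  also have "\<dots> = (\<Sum>e\<in>F. \<Sum>(a, b)\<leftarrow>xs. tensor sA sB e (sB (l e a) b))"
    by (induction xs) (auto simp: sum.distrib simp del: plus_fun_apply zero_fun_apply)
  also have "\<dots> = (\<Sum>e\<in>F. tensor sA sB e (\<Sum>(a, b)\<leftarrow>xs. sB (l e a) b))"
    by (simp add: lin_sum_list[OF lin_tensor_right[OF lin_ident[OF vs(2)]]] case_prod_unfold)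
  also have "\<dots> \<in> tensor_space sA sB UNIV M"
    using slices[OF F(2)] unfolding lift
    by (intro tensor.subspace_sum[OF subspace_tensor_space] tensor_mem) auto
  finally show ?thesis .
qed

lemma tensor_lift_tensor_UNIV:
  assumes "bilin sA sB sW g"
  shows "tensor_lift sA sB UNIV UNIV (tensor sA sB a b) g = g a b"
proof -
  have vs: "vector_space sA" "vector_space sB" "vector_space sW"
    using assms by (auto dest: bilinD linD(1,2))
  show ?thesis
    using tensor_lift_tensor[OF vs module.subspace_UNIV bilin_imp_bilinear_on[OF assms]] vs
    by (simp add: module_iff_vector_space)
qed

section \<open>Sweedler sums\<close>

context coalgebra
begin

text \<open>
  Fixing one representation of each coproduct as a sum of pure tensors makes \<open>sw c g\<close> linear in
  \<open>g\<close> for every function \<open>g\<close>, so that sums can be interchanged and linear maps pulled through without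
  side conditions. Multilinearity of \<open>g\<close> matters only where the coproduct itself is rewritten.
\<close>

definition comult_terms where
  "comult_terms c = (SOME xs. \<Delta> c = (\<Sum>(a, b)\<leftarrow>xs. tensor scale scale a b))"

definition sw where
  "sw c (g :: _ \<Rightarrow> _ \<Rightarrow> 'w::ab_group_add) = (\<Sum>(a, b)\<leftarrow>comult_terms c. g a b)"

lemma comult_eq_sw: "\<Delta> c = sw c (tensor scale scale)"
proof -
  obtain xs where "\<Delta> c = (\<Sum>(a, b)\<leftarrow>xs. tensor scale scale a b)"
    using tensor_space_UNIV_sum_list[OF vector_space_axioms comult_mem] by metis
  then show ?thesis unfolding sw_def comult_terms_def by (rule someI)
qed

lemma tensor_lift_comult:
  assumes "bilin scale scale t g"
  shows "tensor_lift scale scale UNIV UNIV (\<Delta> c) g = sw c g"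
proof -
  have "vector_space t" using assms by (auto dest: bilinD linD(2))
  note lift = tensor_lift_list[OF vector_space_axioms vector_space_axioms this subspace_UNIV
      bilin_imp_bilinear_on[OF assms]]
  show ?thesis
    by (subst comult_eq_sw, unfold sw_def, rule lift) auto
qed

lemma sweedler2_eq_sw: "bilin scale scale t g \<Longrightarrow> sweedler2 scale \<Delta> c g = sw c g"
  unfolding sweedler2_def by (rule tensor_lift_comult)

lemma sw_linear_image: "lin t u l \<Longrightarrow> l (sw c g) = sw c (\<lambda>a b. l (g a b))"
  unfolding sw_def by (simp add: lin_sum_list case_prod_unfold)

lemma sw_cong: "(\<And>a b. g a b = g' a b) \<Longrightarrow> sw c g = sw c g'"
  by (simp add: sw_def)

lemma sw_mem_tensor_space:
  "(\<And>a b. h a b \<in> tensor_space sA sB A B) \<Longrightarrow> sw c h \<in> tensor_space sA sB A B"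
  unfolding sw_def case_prod_unfold by (rule sum_list_mem_tensor_space)

lemma lin_sw_body:
  assumes "\<And>a b. lin s t (\<lambda>x. g x a b)"
  shows "lin s t (\<lambda>x. sw c (\<lambda>a b. g x a b))"
  unfolding sw_def case_prod_unfold by (rule lin_sum_list_body) (rule assms)

lemma lin_sw:
  assumes "bilin scale scale t g"
  shows "lin scale t (\<lambda>c. sw c g)"
proof -
  interpret T: vector_space t using assms by (auto dest: bilinD linD(2))
  note lift = vector_space_axioms vector_space_axioms T.vector_space_axioms subspace_UNIV
    bilin_imp_bilinear_on[OF assms]
  show ?thesis unfolding tensor_lift_comult[OF assms, symmetric]
    by (rule linI)
      (simp_all add: linD[OF comult_linear] tensor_lift_add[OF lift] tensor_lift_scale[OF lift]
        comult_mem vector_space_axioms T.vector_space_axioms)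
qed

lemma lin_sw_arg: "lin s scale F \<Longrightarrow> bilin scale scale t g \<Longrightarrow> lin s t (\<lambda>x. sw (F x) g)"
  using lin_comp[OF lin_sw] .

text \<open>
  The axiom equates two sums of triple tensors; a trilinear map is applied to both through the iterated
  lift, first on the inner and then on the outer tensor product. Read from left to right, the rule
  brings iterated coproducts into right-nested form.
\<close>

lemma sw_coassoc:
  assumes g: "\<And>b c. lin scale t (\<lambda>a. g a b c)" "\<And>a c. lin scale t (\<lambda>b. g a b c)"
    "\<And>a b. lin scale t (\<lambda>c. g a b c)"
  shows "sw c (\<lambda>x y. sw x (\<lambda>a b. g a b y)) = sw c (\<lambda>x y. sw y (\<lambda>a b. g x a b))"
proof -
  let ?T = "tensor_space scale scale UNIV UNIV" and ?t3 = "tensor3 scale scale scale"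
  note V = vector_space_axioms
  have t: "vector_space t" by (rule linD(2)[OF g(1)])
  have blist: "bilin scale scale t (g a)" for a
    by (simp add: bilin_def g)
  note lift = V V t subspace_UNIV bilin_imp_bilinear_on[OF blist]
  define G where "G a u = tensor_lift scale scale UNIV UNIV u (g a)" for a u
  have add: "G (a + a') u = G a u + G a' u" and scale: "G (scale k a) u = t k (G a u)"
    if u_mem: "u \<in> ?T" for a a' u k
  proof -
    obtain xs where u: "u = (\<Sum>(a, b)\<leftarrow>xs. tensor scale scale a b)"
      using tensor_space_UNIV_sum_list[OF V u_mem] by metis
    have G: "G a u = (\<Sum>x\<leftarrow>xs. g a (fst x) (snd x))" for a
      using tensor_lift_list[OF lift, of xs] by (simp add: u G_def case_prod_unfold)
    have "lin scale t (\<lambda>a. \<Sum>x\<leftarrow>xs. g a (fst x) (snd x))"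
      by (rule lin_sum_list_body) (rule g)
    from linD(3)[OF this] linD(4)[OF this]
    show "G (a + a') u = G a u + G a' u" "G (scale k a) u = t k (G a u)"
      unfolding G .
  qed
  have bilG: "bilinear_on scale tensor_scale t UNIV ?T G"
    unfolding bilinear_on_def
    by (auto simp: add scale) (simp_all add: G_def tensor_lift_add[OF lift] tensor_lift_scale[OF lift])
  note lift3 = V tensor.vector_space_axioms t subspace_tensor_space bilG
  define L where "L u = tensor_lift scale tensor_scale UNIV ?T u G" for u
  have mem: "?t3 a b c \<in> tensor_space scale tensor_scale UNIV ?T" for a b c
    unfolding tensor3_def by (intro tensor_mem) auto
  have L3: "L (?t3 a b c) = g a b c" for a b c
    unfolding L_def tensor3_def
    by (simp add: tensor_lift_tensor[OF lift3] tensor_mem G_def tensor_lift_tensor[OF lift])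
  have Lsw: "L (sw d h) = sw d (\<lambda>a b. L (h a b))"
    if "\<And>a b. h a b \<in> tensor_space scale tensor_scale UNIV ?T" for d h
    unfolding sw_def case_prod_unfold L_def by (rule tensor_lift_sum[OF lift3]) (rule that)
  have eq: "sw c (\<lambda>x y. sw x (\<lambda>a b. ?t3 a b y)) = sw c (\<lambda>x y. sw y (\<lambda>a b. ?t3 x a b))"
  proof -
    have b: "bilin scale scale tensor_scale (\<lambda>a b. ?t3 a b y)"
      "bilin scale scale tensor_scale (\<lambda>a b. ?t3 y a b)" for y
      by (intro bilinI lin_tensor3_1 lin_tensor3_2 lin_tensor3_3 lin_ident V)+
    have "bilin scale scale tensor_scale (\<lambda>x y. sw x (\<lambda>a b. ?t3 a b y))"
      "bilin scale scale tensor_scale (\<lambda>x y. sw y (\<lambda>a b. ?t3 x a b))"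
      by (intro bilinI lin_sw_arg lin_sw_body lin_tensor3_1 lin_tensor3_2 lin_tensor3_3 lin_ident V)+
    then show ?thesis
      using coassoc[of c] unfolding sweedler2_eq_sw[OF b(1)] sweedler2_eq_sw[OF b(2)]
      by (simp only: sweedler2_eq_sw)
  qed
  have "L (sw c (\<lambda>x y. sw x (\<lambda>a b. ?t3 a b y))) = sw c (\<lambda>x y. sw x (\<lambda>a b. g a b y))"
    by (simp add: Lsw sw_mem_tensor_space mem L3)
  moreover have "L (sw c (\<lambda>x y. sw y (\<lambda>a b. ?t3 x a b))) = sw c (\<lambda>x y. sw y (\<lambda>a b. g x a b))"
    by (simp add: Lsw sw_mem_tensor_space mem L3)
  ultimately show ?thesis using eq by simp
qed

lemma sw_counit_left: "lin scale t g \<Longrightarrow> sw c (\<lambda>x y. t (\<epsilon> x) (g y)) = g c"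
proof -
  assume g: "lin scale t g"
  have "bilin scale scale scale (\<lambda>x y. scale (\<epsilon> x) y)"
    by (intro bilinI lin_scale_left lin_scale_right lin_ident vector_space_axioms counit_linear)
  then have "g c = g (sw c (\<lambda>x y. scale (\<epsilon> x) y))"
    using counit_left[of c] by (simp add: sweedler2_eq_sw)
  then show ?thesis by (simp add: sw_linear_image[OF g] linD[OF g])
qed

lemma sw_counit_right: "lin scale t g \<Longrightarrow> sw c (\<lambda>x y. t (\<epsilon> y) (g x)) = g c"
proof -
  assume g: "lin scale t g"
  have "bilin scale scale scale (\<lambda>x y. scale (\<epsilon> y) x)"
    by (intro bilinI lin_scale_left lin_scale_right lin_ident vector_space_axioms counit_linear)
  then have "g c = g (sw c (\<lambda>x y. scale (\<epsilon> y) x))"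
    using counit_right[of c] by (simp add: sweedler2_eq_sw)
  then show ?thesis by (simp add: sw_linear_image[OF g] linD[OF g])
qed

text \<open>
  The mechanism behind the cancellations: if \<open>p\<close> merges two consecutive Sweedler factors into the
  counit times \<open>e\<close>, the counit is absorbed by the factor that follows. Instances of \<open>p a b\<close> are
  \<open>S (f a) * f b\<close> and \<open>a * S b\<close>, with \<open>e = 1\<close>.
\<close>

lemma sw_cancel_left:
  assumes p: "bilin scale scale s p" "\<And>x. sw x p = s (\<epsilon> x) e" and G: "bilin s scale t G"
  shows "sw y (\<lambda>a z. sw z (\<lambda>b w. G (p a b) w)) = G e y"
proof -
  note lins = lin_comp[OF bilinD(1)[OF G]] bilinD[OF p(1)] bilinD(2)[OF G]
  have "sw y (\<lambda>a z. sw z (\<lambda>b w. G (p a b) w)) = sw y (\<lambda>x w. sw x (\<lambda>a b. G (p a b) w))"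
    by (rule sw_coassoc[where t = t, symmetric]) (intro lins)+
  also have "\<dots> = sw y (\<lambda>x w. G (sw x p) w)"
    by (simp add: sw_linear_image[OF bilinD(1)[OF G]])
  also have "\<dots> = sw y (\<lambda>x w. t (\<epsilon> x) (G e w))"
    by (simp add: p(2) linD(4)[OF bilinD(1)[OF G]])
  also have "\<dots> = G e y" by (rule sw_counit_left[OF bilinD(2)[OF G]])
  finally show ?thesis .
qed

lemma sw_swap_list: "sw c (\<lambda>a b. \<Sum>x\<leftarrow>xs. g a b x) = (\<Sum>x\<leftarrow>xs. sw c (\<lambda>a b. g a b x))"
proof -
  have "(\<Sum>(a, b)\<leftarrow>ys. \<Sum>x\<leftarrow>xs. g a b x) = (\<Sum>x\<leftarrow>xs. \<Sum>(a, b)\<leftarrow>ys. g a b x)" for ys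
    by (induction ys) (auto simp: sum_list_addf)
  then show ?thesis by (simp add: sw_def)
qed

lemma tensor_lift_sw:
  assumes "bilin sA sB sW g" and h: "\<And>a b. h a b \<in> tensor_space sA sB UNIV UNIV"
  shows "tensor_lift sA sB UNIV UNIV (sw c h) g = sw c (\<lambda>a b. tensor_lift sA sB UNIV UNIV (h a b) g)"
proof -
  have vs: "vector_space sA" "vector_space sB" "vector_space sW"
    using assms by (auto dest: bilinD linD(1,2))
  then have "module.subspace sB UNIV" by (simp add: module_iff_vector_space module.subspace_UNIV)
  then show ?thesis unfolding sw_def case_prod_unfold
    by (rule tensor_lift_sum[OF vs _ bilin_imp_bilinear_on[OF assms(1)]]) (rule h)
qed

lemma sw_scale: "vector_space t \<Longrightarrow> sw c (\<lambda>a b. t k (g a b)) = t k (sw c g)"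
  by (rule sw_linear_image[where t = t and u = t, symmetric]) (intro lin_scale_right lin_ident)

lemma sw_sum: "sw c (\<lambda>a b. \<Sum>e\<in>B. g e a b) = (\<Sum>e\<in>B. sw c (g e))"
proof -
  have "(\<Sum>(a, b)\<leftarrow>xs. \<Sum>e\<in>B. g e a b) = (\<Sum>e\<in>B. \<Sum>(a, b)\<leftarrow>xs. g e a b)" for xs
    by (induction xs) (auto simp: sum.distrib)
  then show ?thesis by (simp add: sw_def)
qed

lemma sw_cong_terms:
  "(\<And>a b. (a, b) \<in> set (comult_terms c) \<Longrightarrow> g a b = g' a b) \<Longrightarrow> sw c g = sw c g'"
  unfolding sw_def by (rule arg_cong[where f = sum_list], rule map_cong) auto

end

lemma sw_swap:
  assumes "coalgebra sC \<Delta>C \<epsilon>C" "coalgebra sD \<Delta>D \<epsilon>D"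
  shows "coalgebra.sw sC \<Delta>C c (\<lambda>a b. coalgebra.sw sD \<Delta>D d (\<lambda>u v. g a b u v)) =
    coalgebra.sw sD \<Delta>D d (\<lambda>u v. coalgebra.sw sC \<Delta>C c (\<lambda>a b. g a b u v))"
  unfolding coalgebra.sw_def[OF assms(2)]
  by (simp add: coalgebra.sw_swap_list[OF assms(1)] case_prod_unfold)

section \<open>The antipode reverses products and coproducts\<close>

context bialgebra
begin

lemmas bialgebra_lins = lin_ident[OF vector_space_axioms] lin_mult_left lin_mult_right
  lin_tensor_left lin_tensor_right lin_tensor3_1 lin_tensor3_2 lin_tensor3_3 lin_sw_body lin_sw_arg bilin_def
  lin_comp[OF counit_linear] lin_field_mult_left lin_field_mult_right

lemma sw_mult:
  assumes "bilin scale scale t g"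
  shows "sw (x * y) g = sw x (\<lambda>x1 x2. sw y (\<lambda>y1 y2. g (x1 * y1) (x2 * y2)))"
proof -
  have "\<Delta> (x * y) = sw x (\<lambda>x1 x2. sw y (\<lambda>y1 y2. tensor scale scale (x1 * y1) (x2 * y2)))"
    unfolding comult_mult
    by (simp add: sweedler2_eq_sw[where t = tensor_scale] bialgebra_lins)
  then show ?thesis
    by (simp add: tensor_lift_comult[OF assms, symmetric] tensor_lift_sw[OF assms] sw_mem_tensor_space
        tensor_mem tensor_lift_tensor_UNIV[OF assms])
qed

lemma sw_one: "bilin scale scale t g \<Longrightarrow> sw 1 g = g 1 1"
  using tensor_lift_comult[of t g 1] by (simp add: comult_one tensor_lift_tensor_UNIV)

lemma sw_mult_left:
  fixes z :: 'h
  shows "sw c (\<lambda>a b. z * g a b) = z * sw c g"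
  by (rule sw_linear_image[where t = scale and u = scale, symmetric]) (intro bialgebra_lins)

lemma sw_mult_right:
  fixes z :: 'h
  shows "sw c (\<lambda>a b. g a b * z) = sw c g * z"
  by (rule sw_linear_image[where t = scale and u = scale and l = "\<lambda>x. x * z", symmetric])
    (intro bialgebra_lins)

end

context hopf_algebra
begin

lemmas hopf_lins = bialgebra_lins lin_comp[OF antipode_linear]

lemma sw_antipode_left: "sw h (\<lambda>a b. S a * b) = scale (\<epsilon> h) 1"
  using antipode_left[of h] by (simp add: sweedler2_eq_sw[where t = scale] hopf_lins)

lemma sw_antipode_right: "sw h (\<lambda>a b. a * S b) = scale (\<epsilon> h) 1"
  using antipode_right[of h] by (simp add: sweedler2_eq_sw[where t = scale] hopf_lins)

lemma counit_antipode: "\<epsilon> (S h) = \<epsilon> h"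
proof -
  have "\<epsilon> (S h) = sw h (\<lambda>a b. \<epsilon> a * \<epsilon> (S b))"
    by (rule sw_counit_left[symmetric]) (intro hopf_lins counit_linear antipode_linear)
  also have "\<dots> = \<epsilon> (sw h (\<lambda>a b. a * S b))"
    by (simp add: sw_linear_image[OF counit_linear] counit_mult)
  also have "\<dots> = \<epsilon> h"
    by (simp add: sw_antipode_right linD(4)[OF counit_linear] counit_one)
  finally show ?thesis .
qed

text \<open>
  In the convolution algebra of bilinear maps \<open>H \<times> H \<rightarrow> H\<close>, \<open>S (x y)\<close> is a left and
  \<open>S y S x\<close> a right inverse of the product, so they agree: \<open>?Z\<close> is the threefold convolution of
  \<open>S (x y)\<close>, \<open>x y\<close> and \<open>S y S x\<close>, bracketed in the two possible ways.
\<close>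

lemma antipode_mult: "S (x * y) = S y * S x"
proof -
  let ?Z = "sw x (\<lambda>x1 x'. sw x' (\<lambda>x2 x3. sw y (\<lambda>y1 y'. sw y' (\<lambda>y2 y3.
    S (x1 * y1) * (x2 * y2 * (S y3 * S x3))))))"
  have "S (x1 * y1) * (x2 * y2 * (S y3 * S x3)) = S (x1 * y1) * (x2 * ((y2 * S y3) * S x3))"
    for x1 x2 x3 y1 y2 y3 by (simp add: mult.assoc)
  then have "?Z = S (x * y)"
    by (simp add: sw_mult_left sw_mult_right sw_antipode_right scale_mult_left scale_mult_right
        sw_counit_right[where t = scale] hopf_lins)
  have "?Z = sw x (\<lambda>x' x3. sw x' (\<lambda>x1 x2. sw y (\<lambda>y' y3. sw y' (\<lambda>y1 y2.
    S (x1 * y1) * (x2 * y2 * (S y3 * S x3))))))"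
    by (simp add: sw_coassoc[where t = scale] hopf_lins)
  also have "\<dots> = sw x (\<lambda>x' x3. sw y (\<lambda>y' y3. sw x' (\<lambda>x1 x2. sw y' (\<lambda>y1 y2.
    S (x1 * y1) * (x2 * y2)))  * (S y3 * S x3)))"
    by (subst sw_swap[OF coalgebra_axioms coalgebra_axioms]) (simp add: sw_mult_right mult.assoc[symmetric])
  also have "\<dots> = sw x (\<lambda>x' x3. sw y (\<lambda>y' y3. sw (x' * y') (\<lambda>a b. S a * b) * (S y3 * S x3)))"
    by (subst sw_mult[where t = scale]) (simp_all add: hopf_lins)
  also have "\<dots> = S y * S x"
    by (simp add: sw_antipode_left counit_mult scale_mult_left sw_scale[OF vector_space_axioms]
        sw_counit_left[where t = scale] hopf_lins scale_scale[symmetric] del: scale_scale)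
  finally show ?thesis using \<open>?Z = S (x * y)\<close> by simp
qed

text \<open>
  Again uniqueness of convolution inverses: \<open>?Z\<close> is the convolution of \<open>\<Delta> (S a)\<close>, \<open>\<Delta>\<close> and
  \<open>S e \<otimes> S d\<close>, evaluated by \<open>g\<close>. Cancelling the last two factors leaves \<open>\<Delta> (S h)\<close>, cancelling the
  first two leaves the flipped \<open>S \<otimes> S\<close>.
\<close>

lemma sw_antipode:
  assumes g: "bilin scale scale t g"
  shows "sw (S h) g = sw h (\<lambda>a b. g (S b) (S a))"
proof -
  let ?Z = "sw h (\<lambda>a r. sw r (\<lambda>b q. sw q (\<lambda>c s. sw s (\<lambda>d e. sw (S a) (\<lambda>u v.
    g (u * b * S e) (v * c * S d))))))"
  have t: "vector_space t" using g by (auto dest: bilinD linD(2))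
  note lins = hopf_lins lin_comp[OF bilinD(1)[OF g]] lin_comp[OF bilinD(2)[OF g]] t
  note swap = sw_swap[OF coalgebra_axioms coalgebra_axioms]
  have "?Z = sw h (\<lambda>a r. t (\<epsilon> r) (sw (S a) g))"
  proof (intro sw_cong)
    fix a r
    have "sw r (\<lambda>b q. sw q (\<lambda>c s. sw s (\<lambda>d e. sw (S a) (\<lambda>u v. g (u * b * S e) (v * c * S d))))) =
      sw r (\<lambda>b q. sw q (\<lambda>c s. sw s (\<lambda>d e. sw (S a) (\<lambda>u v. g (u * b * S e) (v * (c * S d))))))"
      by (simp add: mult.assoc)
    also have "\<dots> = sw r (\<lambda>b q. sw (S a) (\<lambda>u v. g (u * b * S q) (v * 1)))"
      by (intro sw_cong sw_cancel_left[where s = scale and t = t and p = "\<lambda>c d. c * S d"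
            and G = "\<lambda>w e. sw (S a) (\<lambda>u v. g (u * _ * S e) (v * w))"])
        (simp_all add: lins sw_antipode_right)
    also have "\<dots> = sw (S a) (\<lambda>u v. sw r (\<lambda>b q. g (u * (b * S q)) v))"
      by (subst swap) (simp add: mult.assoc)
    also have "\<dots> = sw (S a) (\<lambda>u v. g (sw r (\<lambda>b q. u * (b * S q))) v)"
      by (simp add: sw_linear_image[OF bilinD(1)[OF g]])
    also have "\<dots> = t (\<epsilon> r) (sw (S a) g)"
      by (simp add: sw_mult_left sw_antipode_right scale_mult_right linD(4)[OF bilinD(1)[OF g]] sw_scale[OF t])
    finally show "sw r (\<lambda>b q. sw q (\<lambda>c s. sw s (\<lambda>d e. sw (S a) (\<lambda>u v. g (u * b * S e) (v * c * S d))))) =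
      t (\<epsilon> r) (sw (S a) g)" .
  qed
  also have "\<dots> = sw (S h) g"
    by (rule sw_counit_right) (intro lin_sw_arg antipode_linear g)
  finally have left: "?Z = sw (S h) g" .
  let ?K = "\<lambda>w d e. sw w (\<lambda>u v. g (u * S e) (v * S d))"
  have K: "bilin scale scale t (\<lambda>u v. g (u * S e) (v * S d))" for d e
    by (simp add: lins)
  have "?Z = sw h (\<lambda>a r. sw r (\<lambda>p s. sw p (\<lambda>b c. sw s (\<lambda>d e. sw (S a) (\<lambda>u v.
    g (u * b * S e) (v * c * S d))))))"
    by (simp add: sw_coassoc[where t = t] lins)
  also have "\<dots> = sw h (\<lambda>a r. sw r (\<lambda>p s. sw s (\<lambda>d e. ?K (S a * p) d e)))"
  proof (intro sw_cong)
    fix a p s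
    have "sw p (\<lambda>b c. sw s (\<lambda>d e. sw (S a) (\<lambda>u v. g (u * b * S e) (v * c * S d)))) =
      sw s (\<lambda>d e. sw p (\<lambda>b c. sw (S a) (\<lambda>u v. g (u * b * S e) (v * c * S d))))"
      by (rule swap)
    also have "\<dots> = sw s (\<lambda>d e. sw (S a) (\<lambda>u v. sw p (\<lambda>b c. g (u * b * S e) (v * c * S d))))"
      by (intro sw_cong swap)
    finally show "sw p (\<lambda>b c. sw s (\<lambda>d e. sw (S a) (\<lambda>u v. g (u * b * S e) (v * c * S d)))) =
      sw s (\<lambda>d e. ?K (S a * p) d e)"
      by (simp add: sw_mult[OF K])
  qed
  also have "\<dots> = sw h (\<lambda>x s. sw x (\<lambda>a p. sw s (\<lambda>d e. ?K (S a * p) d e)))"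
    by (simp add: sw_coassoc[where t = t] lins)
  also have "\<dots> = sw h (\<lambda>x s. sw s (\<lambda>d e. ?K (sw x (\<lambda>a p. S a * p)) d e))"
    by (subst swap) (simp add: sw_linear_image[OF lin_sw[OF K]])
  also have "\<dots> = sw h (\<lambda>x s. t (\<epsilon> x) (sw s (\<lambda>d e. ?K 1 d e)))"
    by (simp add: sw_antipode_left linD(4)[OF lin_sw[OF K]] sw_scale[OF t])
  also have "\<dots> = sw h (\<lambda>d e. ?K 1 d e)"
    by (rule sw_counit_left[where g = "\<lambda>s. sw s (\<lambda>d e. ?K 1 d e)"]) (simp add: lins)
  also have "\<dots> = sw h (\<lambda>a b. g (S b) (S a))"
    by (simp add: sw_one[OF K])
  finally show ?thesis using left by simp
qed

end

section \<open>Functionals on a quotient space\<close>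

context vector_space
begin

lemma coset_eq_iff:
  assumes "subspace I"
  shows "coset I x = coset I y \<longleftrightarrow> x - y \<in> I"
proof
  assume "coset I x = coset I y"
  moreover have "x \<in> coset I x" unfolding coset_def using subspace_0[OF assms] by force
  ultimately obtain i where "i \<in> I" "x = y + i" unfolding coset_def by auto
  then show "x - y \<in> I" by simp
next
  have sub: "coset I x \<subseteq> coset I y" if "x - y \<in> I" for x y
    unfolding coset_def
  proof safe
    fix i assume "i \<in> I"
    then show "x + i \<in> (+) y ` I"
      using subspace_add[OF assms that, of i] by (intro image_eqI[of _ _ "x - y + i"]) auto
  qed
  assume "x - y \<in> I"
  then show "coset I x = coset I y"
    using sub[of x y] sub[of y x] subspace_neg[OF assms, of "x - y"] by auto
qed

lemma quotient_add_coset: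
  assumes "subspace I"
  shows "quotient_add I (coset I x) (coset I y) = coset I (x + y)"
proof -
  have "coset I (x' + y') = coset I (x + y)" if "x' \<in> coset I x" "y' \<in> coset I y" for x' y'
    using that subspace_add[OF assms] unfolding coset_eq_iff[OF assms] by (auto simp: coset_def algebra_simps)
  moreover have "x \<in> coset I x" for x unfolding coset_def using subspace_0[OF assms] by force
  ultimately show ?thesis unfolding quotient_add_def by blast
qed

lemma quotient_scale_coset:
  assumes "subspace I"
  shows "quotient_scale scale I k (coset I x) = coset I (scale k x)"
proof -
  have "coset I (scale k x') = coset I (scale k x)" if "x' \<in> coset I x" for x'
    using that subspace_scale[OF assms] unfolding coset_eq_iff[OF assms]
    by (auto simp: coset_def scale_right_distrib)
  moreover have "x \<in> coset I x" unfolding coset_def using subspace_0[OF assms] by force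
  ultimately show ?thesis unfolding quotient_scale_def by blast
qed

text \<open>
  Functionals on the cosets are specified only on the quotient, so they are compared after composition
  with the projection.
\<close>

lemma quotient_dual_eq:
  assumes "subspace I"
  shows "(\<lambda>\<phi> c. \<phi> (coset I c)) ` quotient_dual scale I = {\<psi>. lin scale (*) \<psi> \<and> (\<forall>i\<in>I. \<psi> i = 0)}"
proof safe
  fix \<phi> assume \<phi>: "\<phi> \<in> quotient_dual scale I"
  show lin: "lin scale (*) (\<lambda>c. \<phi> (coset I c))"
    using \<phi> unfolding quotient_dual_def quotient_space_def
    by (intro linI vector_space_axioms vector_space_field)
      (auto simp: quotient_add_coset[OF assms, symmetric] quotient_scale_coset[OF assms, symmetric])
  fix i assume "i \<in> I"
  then have "coset I i = coset I 0" by (simp add: coset_eq_iff[OF assms])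
  then show "\<phi> (coset I i) = 0" using linD(5)[OF lin] by simp
next
  fix \<psi> assume \<psi>: "lin scale (*) \<psi>" "\<forall>i\<in>I. \<psi> i = 0"
  define \<phi> where "\<phi> X = \<psi> (SOME x. x \<in> X)" for X
  have \<phi>: "\<phi> (coset I c) = \<psi> c" for c
  proof -
    have "c \<in> coset I c" unfolding coset_def using subspace_0[OF assms] by force
    then have "(SOME x. x \<in> coset I c) \<in> coset I c" by (rule someI)
    then show ?thesis using \<psi> by (auto simp: \<phi>_def coset_def linD)
  qed
  have "\<phi> \<in> quotient_dual scale I"
    unfolding quotient_dual_def quotient_space_def
    by (auto simp: quotient_add_coset[OF assms] quotient_scale_coset[OF assms] \<phi> linD[OF \<psi>(1)])
  then show "\<psi> \<in> (\<lambda>\<phi> c. \<phi> (coset I c)) ` quotient_dual scale I"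
    using \<phi> by (intro image_eqI[of _ _ \<phi>]) auto
qed

end

section \<open>Exchanging coproduct factors under invariant functionals\<close>

context right_module_coalgebra
begin

text \<open>
  The linear maps that factor through \<open>D\<close>, expressed on \<open>C\<close>.
\<close>

definition invariant where
  "invariant t L \<longleftrightarrow> lin sC t L \<and> (\<forall>c h. L (act c h) = t (\<epsilon>H h) (L c))"

abbreviation CD where "CD \<equiv> C_upper_D \<epsilon>H sC \<Delta>C act"

lemma lin_act_left: "lin s sC F \<Longrightarrow> lin s sC (\<lambda>x. act (F x) h)"
  and lin_act_right: "lin s sH G \<Longrightarrow> lin s sC (\<lambda>x. act c (G x))"
  using bilinear_on_imp_bilin[OF C.vector_space_axioms H.vector_space_axioms C.vector_space_axioms act_bilinear]
  by (auto dest: bilinD intro: lin_comp)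

lemma invariant_functional_iff:
  "invariant (*) \<psi> \<longleftrightarrow> lin sC (*) \<psi> \<and> (\<forall>i\<in>augmentation_coideal \<epsilon>H sC act. \<psi> i = 0)"
proof -
  have "(\<forall>c h. \<psi> (act c h) = \<epsilon>H h * \<psi> c) \<longleftrightarrow> (\<forall>i\<in>augmentation_coideal \<epsilon>H sC act. \<psi> i = 0)"
    if \<psi>: "lin sC (*) \<psi>"
  proof -
    interpret \<psi>: Vector_Spaces.linear sC "(*)" \<psi> by fact
    have diff: "\<psi> (act c h - sC (\<epsilon>H h) c) = \<psi> (act c h) - \<epsilon>H h * \<psi> c" for c h
      by (simp add: \<psi>.diff \<psi>.scale)
    have "\<psi> i = 0" if "\<forall>c h. \<psi> (act c h) = \<epsilon>H h * \<psi> c" and i: "i \<in> augmentation_coideal \<epsilon>H sC act" for i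
      using i unfolding augmentation_coideal_def
      by (induction rule: C.span_induct_alt) (auto simp: \<psi>.zero \<psi>.add \<psi>.scale diff that(1))
    moreover have "act c h - sC (\<epsilon>H h) c \<in> augmentation_coideal \<epsilon>H sC act" for c h
      unfolding augmentation_coideal_def by (rule C.span_base) auto
    ultimately show ?thesis using diff by (metis eq_iff_diff_eq_0)
  qed
  then show ?thesis unfolding invariant_def by blast
qed

lemma mem_C_upper_D_iff:
  "c \<in> CD \<longleftrightarrow>
    (\<forall>\<psi>. invariant (*) \<psi> \<longrightarrow> C.sw c (\<lambda>a b. sC (\<psi> b) a) = C.sw c (\<lambda>a b. sC (\<psi> a) b))"
proof -
  let ?I = "augmentation_coideal \<epsilon>H sC act"
  have I: "C.subspace ?I" unfolding augmentation_coideal_def by (rule C.subspace_span)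
  have sw: "sweedler2 sC \<Delta>C c (\<lambda>a b. sC (\<psi> b) a) = C.sw c (\<lambda>a b. sC (\<psi> b) a)"
    "sweedler2 sC \<Delta>C c (\<lambda>a b. sC (\<psi> a) b) = C.sw c (\<lambda>a b. sC (\<psi> a) b)"
    if "lin sC (*) \<psi>" for \<psi>
    using that
    by (simp_all add: C.sweedler2_eq_sw[where t = sC] bilin_def lin_scale_left lin_scale_right lin_ident
        C.vector_space_axioms)
  have "c \<in> CD \<longleftrightarrow> (\<forall>\<psi>\<in>(\<lambda>\<phi> c. \<phi> (coset ?I c)) ` quotient_dual sC ?I.
      sweedler2 sC \<Delta>C c (\<lambda>a b. sC (\<psi> b) a) = sweedler2 sC \<Delta>C c (\<lambda>a b. sC (\<psi> a) b))"
    unfolding C_upper_D_def Let_def by simp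
  also have "\<dots> \<longleftrightarrow> (\<forall>\<psi>. invariant (*) \<psi> \<longrightarrow>
      C.sw c (\<lambda>a b. sC (\<psi> b) a) = C.sw c (\<lambda>a b. sC (\<psi> a) b))"
    unfolding C.quotient_dual_eq[OF I] invariant_functional_iff using sw by auto
  finally show ?thesis .
qed

text \<open>
  By definition of \<open>C\<^sup>D\<close> the exchange is available for functionals. The finitely many values of \<open>L\<close> that
  occur in the coproduct of \<open>c\<close> are expanded in coordinates, and each coordinate of \<open>L\<close> is an invariant
  functional.
\<close>

lemma C_upper_D_exchange:
  assumes c: "c \<in> CD" and L: "invariant s L" and g: "bilin sC s t g"
  shows "C.sw c (\<lambda>a b. g a (L b)) = C.sw c (\<lambda>a b. g b (L a))"
proof -
  let ?X = "set (C.comult_terms c)"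
  have s: "vector_space s" using g by (auto dest: bilinD linD(1))
  note g1 = bilinD(1)[OF g] and g2 = bilinD(2)[OF g]
  have fin: "finite (L ` (fst ` ?X \<union> snd ` ?X))" by simp
  obtain B l where "finite B" and B: "\<And>e. lin s (*) (l e)"
    "\<And>v. v \<in> L ` (fst ` ?X \<union> snd ` ?X) \<Longrightarrow> v = (\<Sum>e\<in>B. s (l e v) e)"
    by (rule finite_coordinates[OF s fin]) (rule that)
  have expand: "g y (L x) = (\<Sum>e\<in>B. g (sC (l e (L x)) y) e)" if "x \<in> fst ` ?X \<union> snd ` ?X" for x y
  proof -
    have "L x = (\<Sum>e\<in>B. s (l e (L x)) e)" using B(2) that by blast
    then have "g y (L x) = g y (\<Sum>e\<in>B. s (l e (L x)) e)" by (rule arg_cong)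
    also have "\<dots> = (\<Sum>e\<in>B. g y (s (l e (L x)) e))" by (rule lin_sum[OF g2])
    finally show ?thesis by (simp add: linD(4)[OF g1] linD(4)[OF g2])
  qed
  have inv: "invariant (*) (\<lambda>x. l e (L x))" for e
    using L lin_comp[OF B(1)] by (auto simp: invariant_def linD(4)[OF B(1)])
  have "C.sw c (\<lambda>a b. g a (L b)) = C.sw c (\<lambda>a b. \<Sum>e\<in>B. g (sC (l e (L b)) a) e)"
    by (rule C.sw_cong_terms, rule expand) force
  also have "\<dots> = (\<Sum>e\<in>B. g (C.sw c (\<lambda>a b. sC (l e (L b)) a)) e)"
    by (simp add: C.sw_sum C.sw_linear_image[OF g1])
  also have "\<dots> = (\<Sum>e\<in>B. g (C.sw c (\<lambda>a b. sC (l e (L a)) b)) e)"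
    using c inv unfolding mem_C_upper_D_iff by (intro sum.cong refl arg_cong[where f = "\<lambda>x. g x _"]) blast
  also have "\<dots> = C.sw c (\<lambda>a b. \<Sum>e\<in>B. g (sC (l e (L a)) b) e)"
    by (simp add: C.sw_sum C.sw_linear_image[OF g1])
  also have "\<dots> = C.sw c (\<lambda>a b. g b (L a))"
    by (rule C.sw_cong_terms, rule expand[symmetric]) force
  finally show ?thesis .
qed

lemma subspace_C_upper_D: "C.subspace CD"
proof (rule C.subspaceI)
  have lin: "lin sC sC (\<lambda>c. C.sw c (\<lambda>a b. sC (\<psi> b) a))" "lin sC sC (\<lambda>c. C.sw c (\<lambda>a b. sC (\<psi> a) b))"
    if "invariant (*) \<psi>" for \<psi>
    using that unfolding invariant_def
    by (intro C.lin_sw bilinI lin_scale_left lin_scale_right lin_ident C.vector_space_axioms; blast)+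
  show "0 \<in> CD" unfolding mem_C_upper_D_iff using linD(5)[OF lin(1)] linD(5)[OF lin(2)] by simp
  show "x + y \<in> CD" if "x \<in> CD" "y \<in> CD" for x y
    using that unfolding mem_C_upper_D_iff by (simp add: linD(3)[OF lin(1)] linD(3)[OF lin(2)])
  show "sC k x \<in> CD" if "x \<in> CD" for k x
    using that unfolding mem_C_upper_D_iff by (simp add: linD(4)[OF lin(1)] linD(4)[OF lin(2)])
qed

lemma sw_act:
  assumes g: "bilin sC sC t g"
  shows "C.sw (act c h) g = C.sw c (\<lambda>c1 c2. H.sw h (\<lambda>h1 h2. g (act c1 h1) (act c2 h2)))"
proof -
  note lins = lin_act_left lin_act_right lin_ident[OF C.vector_space_axioms] lin_ident[OF H.vector_space_axioms]
    lin_tensor_left lin_tensor_right C.lin_sw_body H.lin_sw_body bilin_def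
  have "\<Delta>C (act c h) = C.sw c (\<lambda>c1 c2. H.sw h (\<lambda>h1 h2. tensor sC sC (act c1 h1) (act c2 h2)))"
    unfolding comult_act
    by (simp add: C.sweedler2_eq_sw[where t = tensor_scale] H.sweedler2_eq_sw[where t = tensor_scale] lins)
  then show ?thesis
    by (simp add: C.tensor_lift_comult[OF g, symmetric] C.tensor_lift_sw[OF g] H.tensor_lift_sw[OF g]
        H.sw_mem_tensor_space tensor_mem tensor_lift_tensor_UNIV[OF g])
qed

lemma act_mem_C_upper_D:
  assumes c: "c \<in> CD"
  shows "act c h \<in> CD"
  unfolding mem_C_upper_D_iff
proof safe
  fix \<psi> assume inv: "invariant (*) \<psi>"
  then have \<psi>: "lin sC (*) \<psi>" and inv': "\<And>c h. \<psi> (act c h) = \<epsilon>H h * \<psi> c" by (auto simp: invariant_def)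
  have act: "act (sC k a) x = sC k (act a x)" "act a (sH k x) = sC k (act a x)" for k a x
    using act_bilinear by (auto simp: bilinear_on_def)
  note lins = lin_ident[OF C.vector_space_axioms] C.vector_space_axioms
  have "C.sw (act c h) (\<lambda>a b. sC (\<psi> b) a) = C.sw c (\<lambda>a b. H.sw h (\<lambda>x y. sC (\<epsilon>H y) (act (sC (\<psi> b) a) x)))"
    by (subst sw_act[where t = sC]) (simp_all add: bilin_def lin_scale_left lin_scale_right lins \<psi> inv' act)
  also have "\<dots> = C.sw c (\<lambda>a b. act (sC (\<psi> b) a) h)"
    by (simp add: H.sw_counit_right[where t = sC] lin_act_right lin_ident H.vector_space_axioms)
  also have "\<dots> = act (C.sw c (\<lambda>a b. sC (\<psi> b) a)) h"
    by (simp add: C.sw_linear_image[OF lin_act_left[OF lins(1)]])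
  also have "\<dots> = act (C.sw c (\<lambda>a b. sC (\<psi> a) b)) h"
    using c inv unfolding mem_C_upper_D_iff by simp
  also have "\<dots> = C.sw c (\<lambda>a b. act (sC (\<psi> a) b) h)"
    by (simp add: C.sw_linear_image[OF lin_act_left[OF lins(1)]])
  also have "\<dots> = C.sw c (\<lambda>a b. H.sw h (\<lambda>x y. sC (\<epsilon>H x) (act (sC (\<psi> a) b) y)))"
    by (simp add: H.sw_counit_left[where t = sC] lin_act_right lin_ident H.vector_space_axioms)
  also have "\<dots> = C.sw (act c h) (\<lambda>a b. sC (\<psi> a) b)"
    by (subst sw_act[where t = sC]) (simp_all add: bilin_def lin_scale_left lin_scale_right lins \<psi> inv' act)
  finally show "C.sw (act c h) (\<lambda>a b. sC (\<psi> b) a) = C.sw (act c h) (\<lambda>a b. sC (\<psi> a) b)" .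
qed

end

section \<open>The anti Yetter-Drinfeld structure\<close>

text \<open>
  A total cointegral that is a coalgebra map; linearity and compatibility with the counits are common
  to both notions.
\<close>

locale coalgebra_cointegral =
  H: hopf_algebra sH \<Delta>H \<epsilon>H S + right_module_coalgebra sH \<Delta>H \<epsilon>H sC \<Delta>C \<epsilon>C act
  for sH :: "'k::field \<Rightarrow> 'h::ring_1 \<Rightarrow> 'h" and \<Delta>H \<epsilon>H S
    and sC :: "'k \<Rightarrow> 'c::ab_group_add \<Rightarrow> 'c" and \<Delta>C \<epsilon>C act +
  fixes f :: "'c \<Rightarrow> 'h"
  assumes f_act: "f (act c h) = f c * h"
    and f_coalgebra_map: "coalgebra_map sC \<Delta>C \<epsilon>C sH \<Delta>H \<epsilon>H f"
begin

lemma f_linear: "lin sC sH f" and f_counit: "\<epsilon>H (f c) = \<epsilon>C c"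
  using f_coalgebra_map by (auto simp: coalgebra_map_def)

lemmas lins = H.hopf_lins C.lin_sw_body C.lin_sw_arg lin_act_left lin_act_right lin_comp[OF f_linear]
  lin_ident[OF C.vector_space_axioms] lin_comp[OF C.counit_linear]
  lin_scale_left[OF C.vector_space_axioms] lin_scale_left[OF H.vector_space_axioms]
  lin_scale_right[of _ sC] lin_scale_right[of _ sH]

abbreviation coaction where "coaction \<equiv> cointegral_coaction sH sC \<Delta>C f (S \<circ> f)"

lemma sw_f:
  assumes g: "bilin sH sH t g"
  shows "H.sw (f c) g = C.sw c (\<lambda>a b. g (f a) (f b))"
proof -
  have "\<Delta>H (f c) = C.sw c (\<lambda>a b. tensor sH sH (f a) (f b))"
    using f_coalgebra_map
    by (simp add: coalgebra_map_def C.sweedler2_eq_sw[where t = tensor_scale] lins)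
  then show ?thesis
    by (simp add: H.tensor_lift_comult[OF g, symmetric] C.tensor_lift_sw[OF g] tensor_mem
        tensor_lift_tensor_UNIV[OF g])
qed

lemma sw_inverse_left: "C.sw c (\<lambda>a b. S (f a) * f b) = sH (\<epsilon>C c) 1"
  using sw_f[of sH "\<lambda>x y. S x * y" c] by (simp add: lins H.sw_antipode_left f_counit)

lemma sw_inverse_right: "C.sw c (\<lambda>a b. f a * S (f b)) = sH (\<epsilon>C c) 1"
  using sw_f[of sH "\<lambda>x y. x * S y" c] by (simp add: lins H.sw_antipode_right f_counit)

lemma convolution_inverse_f: "convolution_inverse sC \<Delta>C \<epsilon>C sH f (S \<circ> f)"
  unfolding convolution_inverse_def comp_def
  by (simp add: C.sweedler2_eq_sw[where t = sH] lins H.antipode_linear f_linear sw_inverse_left sw_inverse_right)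

lemma sw_cancel:
  assumes "bilin sH sC t G"
  shows "C.sw y (\<lambda>a z. C.sw z (\<lambda>b w. G (S (f a) * f b) w)) = G 1 y"
  by (rule C.sw_cancel_left[OF _ sw_inverse_left assms]) (simp add: lins)

lemma sweedler3_C:
  assumes "\<And>y z. lin sC t (\<lambda>x. g x y z)" "\<And>x z. lin sC t (\<lambda>y. g x y z)" "\<And>x y. lin sC t (\<lambda>z. g x y z)"
  shows "sweedler3 sC \<Delta>C c g = C.sw c (\<lambda>x r. C.sw r (\<lambda>y z. g x y z))"
  unfolding sweedler3_def
  by (simp add: C.sweedler2_eq_sw[where t = t] bilin_def assms C.lin_sw_body C.lin_sw)

lemma coaction_eq:
  "coaction c = C.sw c (\<lambda>c1 r. C.sw r (\<lambda>c2 c3. tensor sH sC (S (f c3) * f c1) c2))"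
  unfolding cointegral_coaction_def comp_def
  by (rule sweedler3_C[where t = tensor_scale]) (simp_all add: lins)

lemma lin_coaction: "lin sC tensor_scale coaction"
  unfolding coaction_eq by (simp add: lins)

lemma tensor_lift_coaction_UNIV:
  assumes g: "bilin sH sC t g"
  shows "tensor_lift sH sC UNIV UNIV (coaction c) g =
    C.sw c (\<lambda>c1 r. C.sw r (\<lambda>c2 c3. g (S (f c3) * f c1) c2))"
  unfolding coaction_eq
  by (simp add: C.tensor_lift_sw[OF g] C.sw_mem_tensor_space tensor_mem tensor_lift_tensor_UNIV[OF g])

text \<open>
  If \<open>\<psi>\<close> factors through \<open>D\<close>, this is \<open>(id \<otimes> \<psi>)\<close> applied to the coaction
  \<open>\<pi> b \<mapsto> f b1 S (f b3) \<otimes> \<pi> b2\<close> of \<open>H\<close> on \<open>D\<close>. It provides the additional factor of \<open>H\<close> that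
  cancels a factor of the coaction on \<open>C\<close>.
\<close>

definition inner_twist where
  "inner_twist \<psi> b = C.sw b (\<lambda>b1 r. C.sw r (\<lambda>b2 b3. sH (\<psi> b2) (f b1 * S (f b3))))"

lemma lin_inner_twist:
  assumes "lin sC (*) \<psi>"
  shows "lin sC sH (inner_twist \<psi>)"
  unfolding inner_twist_def by (simp add: lins lin_comp[OF assms])

text \<open>
  For \<open>b h\<close> the factor in the middle produces \<open>\<epsilon>(h2)\<close>, after which the outer ones meet in \<open>h1 S h2\<close>.
\<close>

lemma invariant_inner_twist:
  assumes "invariant (*) \<psi>"
  shows "invariant sH (inner_twist \<psi>)"
  unfolding invariant_def
proof (intro conjI allI)
  have \<psi>: "lin sC (*) \<psi>" and inv: "\<And>c h. \<psi> (act c h) = \<epsilon>H h * \<psi> c"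
    using assms by (auto simp: invariant_def)
  note lins = lins lin_comp[OF \<psi>]
  show "lin sC sH (inner_twist \<psi>)" by (rule lin_inner_twist[OF \<psi>])
  fix b h
  have "inner_twist \<psi> (act b h) = C.sw b (\<lambda>b1 r. H.sw h (\<lambda>h1 s. C.sw r (\<lambda>b2 b3. H.sw s (\<lambda>h2 h3.
      sH (\<epsilon>H h2) (sH (\<psi> b2) (f b1 * h1 * (S h3 * S (f b3))))))))"
    unfolding inner_twist_def
    by (simp add: sw_act[where t = sH] lins inv f_act H.antipode_mult)
  also have "\<dots> = C.sw b (\<lambda>b1 r. H.sw h (\<lambda>h1 s. C.sw r (\<lambda>b2 b3.
      sH (\<psi> b2) (f b1 * ((h1 * S s) * S (f b3))))))"
    by (intro C.sw_cong H.sw_cong, unfold mult.assoc, rule H.sw_counit_left) (simp add: lins)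
  also have "\<dots> = C.sw b (\<lambda>b1 r. C.sw r (\<lambda>b2 b3. H.sw h (\<lambda>h1 s.
      sH (\<psi> b2) (f b1 * ((h1 * S s) * S (f b3))))))"
    by (intro C.sw_cong sw_swap[OF H.coalgebra_axioms C.coalgebra_axioms])
  also have "\<dots> = sH (\<epsilon>H h) (inner_twist \<psi> b)"
    unfolding inner_twist_def
    by (simp add: H.sw_scale[OF H.vector_space_axioms] H.sw_mult_left H.sw_mult_right H.sw_antipode_right
        H.scale_mult_left H.scale_mult_right C.sw_scale[OF H.vector_space_axioms, symmetric] mult.commute)
  finally show "inner_twist \<psi> (act b h) = sH (\<epsilon>H h) (inner_twist \<psi> b)" .
qed

text \<open>
  The map \<open>?\<Phi>\<close> is \<open>\<Phi>\<close> as described at the beginning, contracted with \<open>l\<close>; the facts \<open>left\<close> and \<open>right\<close> below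
  are its two evaluations, and \<open>C_upper_D_exchange\<close> for \<open>inner_twist \<psi>\<close> equates them.
\<close>

lemma slice_mem_C_upper_D:
  assumes c: "c \<in> CD" and l: "lin sH (*) l"
  shows "C.sw c (\<lambda>c1 r. C.sw r (\<lambda>c2 c3. sC (l (S (f c3) * f c1)) c2)) \<in> CD"
  unfolding mem_C_upper_D_iff
proof safe
  fix \<psi> assume inv: "invariant (*) \<psi>"
  then have \<psi>: "lin sC (*) \<psi>" by (simp add: invariant_def)
  note lins = lins lin_comp[OF \<psi>] lin_comp[OF l]
  let ?slice = "C.sw c (\<lambda>c1 r. C.sw r (\<lambda>c2 c3. sC (l (S (f c3) * f c1)) c2))"
  let ?L = "inner_twist \<psi>"
  let ?\<Phi> = "\<lambda>a w. C.sw a (\<lambda>a1 r. C.sw r (\<lambda>a2 a3. sC (l (S (f a3) * w * f a1)) a2))"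
  have \<Phi>: "bilin sC sH sC ?\<Phi>" by (simp add: lins)
  have slice: "C.sw ?slice G = C.sw c (\<lambda>c1 r. C.sw r (\<lambda>a q. C.sw q (\<lambda>b c3.
      sC (l (S (f c3) * f c1)) (G a b))))" if G: "bilin sC sC sC G" for G
  proof -
    note G' = lin_comp[OF bilinD(1)[OF G]] lin_comp[OF bilinD(2)[OF G]]
    have "C.sw ?slice G = C.sw c (\<lambda>c1 r. C.sw r (\<lambda>c2 c3. C.sw c2 (\<lambda>a b.
        sC (l (S (f c3) * f c1)) (G a b))))"
      by (simp add: C.sw_linear_image[OF C.lin_sw[OF G]] linD(4)[OF C.lin_sw[OF G]]
          C.sw_scale[OF C.vector_space_axioms])
    also have "\<dots> = C.sw c (\<lambda>c1 r. C.sw r (\<lambda>a q. C.sw q (\<lambda>b c3. sC (l (S (f c3) * f c1)) (G a b))))"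
      by (simp add: C.sw_coassoc[where t = sC] lins G')
    finally show ?thesis .
  qed
  have expand: "K (?L y) = C.sw y (\<lambda>b1 r. C.sw r (\<lambda>b2 b3. sC (\<psi> b2) (K (f b1 * S (f b3)))))"
    if "lin sH sC K" for K y
    unfolding inner_twist_def by (simp add: C.sw_linear_image[OF that] linD(4)[OF that])
  have left: "C.sw c (\<lambda>x y. ?\<Phi> x (?L y)) = C.sw c (\<lambda>c1 r. C.sw r (\<lambda>a q. C.sw q (\<lambda>b c3.
      sC (l (S (f c3) * f c1)) (sC (\<psi> b) a))))"
  proof -
    have "C.sw c (\<lambda>x y. ?\<Phi> x (?L y)) = C.sw c (\<lambda>a1 r. C.sw r (\<lambda>a2 q. C.sw q (\<lambda>a3 y.
        sC (l (S (f a3) * ?L y * f a1)) a2)))"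
      by (simp add: C.sw_coassoc[where t = sC] lins lin_comp[OF lin_inner_twist[OF \<psi>]])
    also have "\<dots> = C.sw c (\<lambda>c1 r. C.sw r (\<lambda>a q. C.sw q (\<lambda>b c3.
        sC (l (S (f c3) * f c1)) (sC (\<psi> b) a))))"
    proof (rule C.sw_cong, rule C.sw_cong)
      fix a1 a2 q
      \<comment> \<open>The factor \<open>w\<close> marks the place of \<open>S (f c3) * f c4\<close>, which cancels.\<close>
      let ?G = "\<lambda>w r. C.sw r (\<lambda>b2 b3. sC (\<psi> b2) (sC (l (w * (S (f b3) * f a1))) a2))"
      have "C.sw q (\<lambda>a3 y. sC (l (S (f a3) * ?L y * f a1)) a2) =
        C.sw q (\<lambda>a3 y. C.sw y (\<lambda>b1 r. ?G (S (f a3) * f b1) r))"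
      proof (intro C.sw_cong)
        fix a3 y
        have "lin sH sC (\<lambda>w. sC (l (S (f a3) * w * f a1)) a2)" by (simp add: lins)
        from expand[OF this] show "sC (l (S (f a3) * ?L y * f a1)) a2 = C.sw y (\<lambda>b1 r. ?G (S (f a3) * f b1) r)"
          by (simp add: mult.assoc)
      qed
      also have "\<dots> = ?G 1 q"
        by (rule sw_cancel[where t = sC and G = ?G]) (simp add: lins)
      finally show "C.sw q (\<lambda>a3 y. sC (l (S (f a3) * ?L y * f a1)) a2) =
        C.sw q (\<lambda>b c3. sC (l (S (f c3) * f a1)) (sC (\<psi> b) a2))"
        by (simp add: mult.commute)
    qed
    finally show ?thesis .
  qed
  have right: "C.sw c (\<lambda>x y. ?\<Phi> y (?L x)) = C.sw c (\<lambda>c1 r. C.sw r (\<lambda>a q. C.sw q (\<lambda>b c3.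
      sC (l (S (f c3) * f c1)) (sC (\<psi> a) b))))"
  proof -
    \<comment> \<open>Here \<open>w\<close> marks the place of \<open>S (f c3) * f c4\<close> at the right end of the argument of \<open>l\<close>.\<close>
    let ?F = "\<lambda>b1 b2 w s. C.sw s (\<lambda>a2 a3. sC (\<psi> b2) (sC (l (S (f a3) * f b1 * w)) a2))"
    have "C.sw c (\<lambda>x y. ?\<Phi> y (?L x)) = C.sw c (\<lambda>x y. C.sw x (\<lambda>b1 r. C.sw r (\<lambda>b2 b3.
        C.sw y (\<lambda>a1 s. ?F b1 b2 (S (f b3) * f a1) s))))"
    proof (rule C.sw_cong)
      fix x y
      show "?\<Phi> y (?L x) = C.sw x (\<lambda>b1 r. C.sw r (\<lambda>b2 b3. C.sw y (\<lambda>a1 s. ?F b1 b2 (S (f b3) * f a1) s)))"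
        using expand[OF bilinD(2)[OF \<Phi>], of y x]
        by (simp only: C.sw_scale[OF C.vector_space_axioms] mult.assoc)
    qed
    also have "\<dots> = C.sw c (\<lambda>b1 r. C.sw r (\<lambda>b2 q. C.sw q (\<lambda>b3 y.
        C.sw y (\<lambda>a1 s. ?F b1 b2 (S (f b3) * f a1) s))))"
      by (simp add: C.sw_coassoc[where t = sC] lins)
    also have "\<dots> = C.sw c (\<lambda>b1 r. C.sw r (\<lambda>b2 q. ?F b1 b2 1 q))"
      by (intro C.sw_cong sw_cancel[where t = sC and G = "?F _ _"]) (simp add: lins)
    finally show ?thesis by (simp add: mult.commute)
  qed
  have "C.sw ?slice (\<lambda>a b. sC (\<psi> b) a) = C.sw c (\<lambda>x y. ?\<Phi> x (?L y))"
    unfolding left by (rule slice) (simp add: lins)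
  also have "\<dots> = C.sw c (\<lambda>x y. ?\<Phi> y (?L x))"
    by (rule C_upper_D_exchange[OF c invariant_inner_twist[OF inv] \<Phi>])
  also have "\<dots> = C.sw ?slice (\<lambda>a b. sC (\<psi> a) b)"
    unfolding right by (rule slice[symmetric]) (simp add: lins)
  finally show "C.sw ?slice (\<lambda>a b. sC (\<psi> b) a) = C.sw ?slice (\<lambda>a b. sC (\<psi> a) b)" .
qed

lemma coaction_mem:
  assumes "c \<in> CD"
  shows "coaction c \<in> tensor_space sH sC UNIV CD"
proof (rule mem_tensor_space_if_slices_mem[OF H.vector_space_axioms C.vector_space_axioms])
  show "coaction c \<in> tensor_space sH sC UNIV UNIV"
    unfolding coaction_eq by (intro C.sw_mem_tensor_space tensor_mem) auto
  fix l assume l: "lin sH (*) l"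
  have "bilin sH sC sC (\<lambda>a b. sC (l a) b)" by (simp add: lins lin_comp[OF l] l)
  then show "tensor_lift sH sC UNIV UNIV (coaction c) (\<lambda>a b. sC (l a) b) \<in> CD"
    using slice_mem_C_upper_D[OF assms l] by (simp add: tensor_lift_coaction_UNIV[where t = sC])
qed

lemma tensor_lift_coaction:
  assumes "c \<in> CD" and g': "bilin sH sC t g'" and "\<And>x n. n \<in> CD \<Longrightarrow> g x n = g' x n"
  shows "tensor_lift sH sC UNIV CD (coaction c) g =
    C.sw c (\<lambda>c1 r. C.sw r (\<lambda>c2 c3. g' (S (f c3) * f c1) c2))"
  using tensor_lift_restrict[OF H.vector_space_axioms C.vector_space_axioms subspace_C_upper_D coaction_mem g']
    assms by (simp add: tensor_lift_coaction_UNIV[OF g'])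

text \<open>
  Both sides are \<open>S (f c5) f c1 \<otimes> S (f c4) f c2 \<otimes> c3\<close>.
\<close>

lemma coaction_coassoc:
  assumes c: "c \<in> CD"
  shows "tensor_lift sH sC UNIV CD (coaction c)
      (\<lambda>x n. sweedler2 sH \<Delta>H x (\<lambda>a b. tensor3 sH sH sC a b n)) =
    tensor_lift sH sC UNIV CD (coaction c)
      (\<lambda>x n. tensor_lift sH sC UNIV CD (coaction n) (\<lambda>a p. tensor3 sH sH sC x a p))"
proof -
  let ?t = "tensor3 sH sH sC"
  note swap = sw_swap[OF C.coalgebra_axioms C.coalgebra_axioms]
  have "tensor_lift sH sC UNIV CD (coaction c) (\<lambda>x n. sweedler2 sH \<Delta>H x (\<lambda>a b. ?t a b n)) =
    C.sw c (\<lambda>c1 r. C.sw r (\<lambda>c2 c3. H.sw (S (f c3) * f c1) (\<lambda>a b. ?t a b c2)))"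
    by (rule tensor_lift_coaction[OF c, where t = tensor_scale])
      (simp_all add: lins H.sweedler2_eq_sw[where t = tensor_scale])
  also have "\<dots> = C.sw c (\<lambda>c1 r. C.sw r (\<lambda>c2 c3. C.sw c3 (\<lambda>u v. C.sw c1 (\<lambda>a b.
      ?t (S (f v) * f a) (S (f u) * f b) c2))))"
    by (simp add: H.sw_mult[where t = tensor_scale] H.sw_antipode[where t = tensor_scale]
        sw_f[where t = tensor_scale] lins)
  also have "\<dots> = C.sw c (\<lambda>c1 r. C.sw c1 (\<lambda>a b. C.sw r (\<lambda>c2 c3. C.sw c3 (\<lambda>u v.
      ?t (S (f v) * f a) (S (f u) * f b) c2))))"
  proof (intro C.sw_cong)
    fix c1 r
    let ?g = "\<lambda>c2 u v a b. ?t (S (f v) * f a) (S (f u) * f b) c2"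
    have "C.sw r (\<lambda>c2 c3. C.sw c3 (\<lambda>u v. C.sw c1 (\<lambda>a b. ?g c2 u v a b))) =
      C.sw r (\<lambda>c2 c3. C.sw c1 (\<lambda>a b. C.sw c3 (\<lambda>u v. ?g c2 u v a b)))"
      by (intro C.sw_cong swap)
    also have "\<dots> = C.sw c1 (\<lambda>a b. C.sw r (\<lambda>c2 c3. C.sw c3 (\<lambda>u v. ?g c2 u v a b)))"
      by (rule swap)
    finally show "C.sw r (\<lambda>c2 c3. C.sw c3 (\<lambda>u v. C.sw c1 (\<lambda>a b. ?g c2 u v a b))) =
      C.sw c1 (\<lambda>a b. C.sw r (\<lambda>c2 c3. C.sw c3 (\<lambda>u v. ?g c2 u v a b)))" .
  qed
  also have "\<dots> = C.sw c (\<lambda>c1 r. C.sw r (\<lambda>c2 c3. C.sw c2 (\<lambda>a q. C.sw q (\<lambda>p b.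
      ?t (S (f c3) * f c1) (S (f b) * f a) p))))"
    by (simp add: C.sw_coassoc[where t = tensor_scale] lins)
  also have "\<dots> = tensor_lift sH sC UNIV CD (coaction c)
      (\<lambda>x n. tensor_lift sH sC UNIV CD (coaction n) (\<lambda>a p. ?t x a p))"
  proof (rule tensor_lift_coaction[OF c, where t = tensor_scale, symmetric])
    show "tensor_lift sH sC UNIV CD (coaction n) (\<lambda>a p. ?t x a p) =
      C.sw n (\<lambda>a q. C.sw q (\<lambda>p b. ?t x (S (f b) * f a) p))" if "n \<in> CD" for x n
      by (rule tensor_lift_coaction[OF that, where t = tensor_scale]) (simp_all add: lins)
  qed (simp add: lins)
  finally show ?thesis .
qed

lemma coaction_counit:
  assumes c: "c \<in> CD"
  shows "tensor_lift sH sC UNIV CD (coaction c) (\<lambda>x n. sC (\<epsilon>H x) n) = c"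
proof -
  have "tensor_lift sH sC UNIV CD (coaction c) (\<lambda>x n. sC (\<epsilon>H x) n) =
    C.sw c (\<lambda>c1 r. C.sw r (\<lambda>c2 c3. sC (\<epsilon>H (S (f c3) * f c1)) c2))"
    by (rule tensor_lift_coaction[OF c, where t = sC]) (simp_all add: lins H.counit_linear)
  also have "\<dots> = C.sw c (\<lambda>c1 r. C.sw r (\<lambda>c2 c3. sC (\<epsilon>C c3) (sC (\<epsilon>C c1) c2)))"
    by (simp add: H.counit_mult H.counit_antipode f_counit mult.commute)
  also have "\<dots> = C.sw c (\<lambda>c1 r. sC (\<epsilon>C c1) r)"
    by (simp only: C.sw_counit_right[where t = sC] lins)
  also have "\<dots> = c"
    by (rule C.sw_counit_left[where g = "\<lambda>x. x"]) (simp add: lins)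
  finally show ?thesis .
qed

lemma coaction_act:
  assumes c: "c \<in> CD"
  shows "coaction (act c h) = tensor_lift sH sC UNIV CD (coaction c)
    (\<lambda>x n. sweedler3 sH \<Delta>H h (\<lambda>h1 h2 h3. tensor sH sC (S h3 * x * h1) (act n h2)))"
proof -
  have "coaction (act c h) = C.sw c (\<lambda>c1 r. H.sw h (\<lambda>h1 s. C.sw r (\<lambda>c2 c3. H.sw s (\<lambda>h2 h3.
      tensor sH sC (S h3 * (S (f c3) * f c1) * h1) (act c2 h2)))))"
    unfolding coaction_eq
    by (simp add: sw_act[where t = tensor_scale] lins f_act H.antipode_mult mult.assoc)
  also have "\<dots> = C.sw c (\<lambda>c1 r. C.sw r (\<lambda>c2 c3. H.sw h (\<lambda>h1 s. H.sw s (\<lambda>h2 h3.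
      tensor sH sC (S h3 * (S (f c3) * f c1) * h1) (act c2 h2)))))"
    by (intro C.sw_cong sw_swap[OF H.coalgebra_axioms C.coalgebra_axioms])
  also have "\<dots> = tensor_lift sH sC UNIV CD (coaction c)
    (\<lambda>x n. sweedler3 sH \<Delta>H h (\<lambda>h1 h2 h3. tensor sH sC (S h3 * x * h1) (act n h2)))"
    by (rule tensor_lift_coaction[OF c, where t = tensor_scale, symmetric])
      (simp_all add: lins sweedler3_def H.sweedler2_eq_sw[where t = tensor_scale])
  finally show ?thesis .
qed

lemma anti_yetter_drinfeld_C_upper_D:
  "right_left_anti_yetter_drinfeld_module sH \<Delta>H \<epsilon>H S sC CD act coaction"
proof unfold_locales
  show "bilinear_on sC sH sC CD UNIV act"
    using act_bilinear by (simp add: bilinear_on_def)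
qed (simp_all add: subspace_C_upper_D act_mem_C_upper_D act_one act_mult coaction_mem linD(3,4)[OF lin_coaction]
  coaction_coassoc coaction_counit coaction_act)

lemma stable_C_upper_D:
  assumes "\<forall>c\<in>CD. c = sweedler3 sC \<Delta>C c (\<lambda>c1 c2 c3. act c2 ((S \<circ> f) c3 * f c1))"
  shows "stable_on sH sC CD act coaction"
  unfolding stable_on_def
proof
  fix c assume c: "c \<in> CD"
  have "tensor_lift sH sC UNIV CD (coaction c) (\<lambda>x n. act n x) =
    C.sw c (\<lambda>c1 r. C.sw r (\<lambda>c2 c3. act c2 (S (f c3) * f c1)))"
    by (rule tensor_lift_coaction[OF c, where t = sC]) (simp_all add: lins)
  also have "\<dots> = sweedler3 sC \<Delta>C c (\<lambda>c1 c2 c3. act c2 ((S \<circ> f) c3 * f c1))"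
    unfolding comp_def by (rule sweedler3_C[where t = sC, symmetric]) (simp_all add: lins)
  finally show "tensor_lift sH sC UNIV CD (coaction c) (\<lambda>x n. act n x) = c"
    using assms c by simp
qed

end

theorem proposition3p20:
  fixes sH :: "'k::field \<Rightarrow> 'h::ring_1 \<Rightarrow> 'h"
    and \<Delta>H :: "'h \<Rightarrow> ('k, 'h, 'h) tensor" and \<epsilon>H :: "'h \<Rightarrow> 'k" and S :: "'h \<Rightarrow> 'h"
    and sC :: "'k \<Rightarrow> 'c::ab_group_add \<Rightarrow> 'c"
    and \<Delta>C :: "'c \<Rightarrow> ('k, 'c, 'c) tensor" and \<epsilon>C :: "'c \<Rightarrow> 'k"
    and act :: "'c \<Rightarrow> 'h \<Rightarrow> 'c" and f :: "'c \<Rightarrow> 'h"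
  assumes "hopf_algebra sH \<Delta>H \<epsilon>H S"
    and "right_module_coalgebra sH \<Delta>H \<epsilon>H sC \<Delta>C \<epsilon>C act"
    and "total_cointegral sH \<epsilon>H sC \<epsilon>C act f"
    and "coalgebra_map sC \<Delta>C \<epsilon>C sH \<Delta>H \<epsilon>H f"
  shows "convolution_inverse sC \<Delta>C \<epsilon>C sH f (S \<circ> f) \<and>
    right_left_anti_yetter_drinfeld_module sH \<Delta>H \<epsilon>H S
      sC (C_upper_D \<epsilon>H sC \<Delta>C act) act (cointegral_coaction sH sC \<Delta>C f (S \<circ> f)) \<and>
    ((\<forall>c \<in> C_upper_D \<epsilon>H sC \<Delta>C act.
        c = sweedler3 sC \<Delta>C c (\<lambda>c1 c2 c3. act c2 ((S \<circ> f) c3 * f c1))) \<longrightarrow>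
      stable_on sH sC (C_upper_D \<epsilon>H sC \<Delta>C act) act (cointegral_coaction sH sC \<Delta>C f (S \<circ> f)))"
proof -
  interpret coalgebra_cointegral sH \<Delta>H \<epsilon>H S sC \<Delta>C \<epsilon>C act f
    using assms
    by (simp add: coalgebra_cointegral_def coalgebra_cointegral_axioms_def total_cointegral_def)
  show ?thesis
    using convolution_inverse_f anti_yetter_drinfeld_C_upper_D stable_C_upper_D by blast
qed

end
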